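(* Let $\mathcal{Q}=(P_1,P_2,P_3,P_4)$ be a quadruplet of points in $S^3$ which are not cocircular, let $\mathcal{Q}'=(P_1',P_2',P_3',P_4')$ be its dual quadruplet, and let $\mathcal{Q}''=(\mathcal{Q}')'$ be the dual quadruplet of $\mathcal{Q}'$. Then $\mathcal{Q}''=\mathcal{Q}$.
   Context: Let $P_1,P_2,P_3,P_4$ be four points of the round sphere $S^3$ which are not cocircular, i.e. do not lie on a common round circle (in particular they are distinct); they lie on a (unique) round $2$-sphere $\varSigma\subset S^3$. For pairwise distinct $i,j,k\in\{1,2,3,4\}$ let $\varGamma_{ijk}$ be the circle through $P_i,P_j,P_k$, oriented by the cyclic order $P_i\to P_j\to P_k\to P_i$. The angle between two oriented circles through $P_i$ and $P_j$ is the angle in $[0,\pi]$ between their positive unit tangent vectors at $P_i$ (equivalently at $P_j$). For $\{i,j,k,l\}=\{1,2,3,4\}$ let $\mathcal{S}_{ij}$ be the set of oriented circles in $S^3$ through $P_i$ and $P_j$ which intersect $\varGamma_{ijk}$ and $\varGamma_{ijl}$ in the same angle. The circular angle bisector $\varGamma_{ij}$ of $\varGamma_{ijk}$ and $\varGamma_{ijl}$ is the (unique) circle in $\mathcal{S}_{ij}$ which minimizes the intersection angles with $\varGamma_{ijk}$ and $\varGamma_{ijl}$; it lies on $\varSigma$. The dual quadruplet $\mathcal{Q}'=(P_1',P_2',P_3',P_4')$ of $\mathcal{Q}=(P_1,P_2,P_3,P_4)$ is defined by $\varGamma_{ij}\cap\varGamma_{ik}\cap\varGamma_{il}=\{P_i,P_i'\}$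 for $\{i,j,k,l\}=\{1,2,3,4\}$. Equivalently: if $\pi_i:\varSigma\to\varPi_i\cup\{\infty\}$ is a stereographic projection from $P_i$ onto a Euclidean plane $\varPi_i$, then $P_i'=\pi_i^{-1}(\text{incenter of the triangle with vertices }\pi_i(P_j),\pi_i(P_k),\pi_i(P_l))$. The dual of a non-cocircular quadruplet is again non-cocircular, so that its dual is defined. *)

theory Defs
  imports "HOL-Analysis.Analysis"
begin

abbreviation S3 :: "(real^4) set" where
  "S3 \<equiv> sphere 0 1"

text \<open>
  An oriented round circle is represented by its lift to the unit tangent bundle: the set of all
  pairs of a point of the circle and the positive unit tangent vector at that point.  Thus two
  oriented circles are equal iff they have the same points and the same orientation, independently
  of the parametrisation.
\<close>

type_synonym ocircle = "((real^4) \<times> (real^4)) set"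

definition circle_pt :: "real^4 \<Rightarrow> real \<Rightarrow> real^4 \<Rightarrow> real^4 \<Rightarrow> real \<Rightarrow> real^4" where
  "circle_pt c r u v t = c + r *\<^sub>R (cos t *\<^sub>R u + sin t *\<^sub>R v)"

definition circle_tan :: "real^4 \<Rightarrow> real^4 \<Rightarrow> real \<Rightarrow> real^4" where
  "circle_tan u v t = - sin t *\<^sub>R u + cos t *\<^sub>R v"

definition circle_frame :: "real \<Rightarrow> real^4 \<Rightarrow> real^4 \<Rightarrow> bool" where
  "circle_frame r u v \<longleftrightarrow> r > 0 \<and> norm u = 1 \<and> norm v = 1 \<and> u \<bullet> v = 0"

definition ocirc :: "real^4 \<Rightarrow> real \<Rightarrow> real^4 \<Rightarrow> real^4 \<Rightarrow> ocircle" where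
  "ocirc c r u v = range (\<lambda>t. (circle_pt c r u v t, circle_tan u v t))"

definition points :: "ocircle \<Rightarrow> (real^4) set" where
  "points K = fst ` K"

definition ocircles_S3 :: "ocircle set" where
  "ocircles_S3 = {ocirc c r u v | c r u v. circle_frame r u v \<and> points (ocirc c r u v) \<subseteq> S3}"

definition tangent_at :: "ocircle \<Rightarrow> real^4 \<Rightarrow> real^4" where
  "tangent_at K p = (THE w. (p, w) \<in> K)"

definition cocircular :: "(real^4) set \<Rightarrow> bool" where
  "cocircular A \<longleftrightarrow> (\<exists>K \<in> ocircles_S3. A \<subseteq> points K)"

text \<open>The angle at the common point \<open>p\<close>; positive tangent vectors have norm 1.\<close>

definition oangle :: "real^4 \<Rightarrow> ocircle \<Rightarrow> ocircle \<Rightarrow> real" where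
  "oangle p K L = arccos (tangent_at K p \<bullet> tangent_at L p)"

text \<open>
  The circle through three distinct points, oriented by the cyclic order
  \<open>p \<rightarrow> q \<rightarrow> s \<rightarrow> p\<close>: starting at \<open>p\<close> and moving in the positive direction, one meets \<open>q\<close> and
  then \<open>s\<close> within one turn.
\<close>

definition circle3 :: "real^4 \<Rightarrow> real^4 \<Rightarrow> real^4 \<Rightarrow> ocircle" where
  "circle3 p q s = (THE K. K \<in> ocircles_S3 \<and>
     (\<exists>c r u v t1 t2 t3. circle_frame r u v \<and> K = ocirc c r u v \<and>
        t1 < t2 \<and> t2 < t3 \<and> t3 < t1 + 2 * pi \<and>
        circle_pt c r u v t1 = p \<and> circle_pt c r u v t2 = q \<and> circle_pt c r u v t3 = s))"

definition equiangular_circles :: "real^4 \<Rightarrow> real^4 \<Rightarrow> ocircle \<Rightarrow> ocircle \<Rightarrow> ocircle set" where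
  "equiangular_circles p q K L =
     {M \<in> ocircles_S3. p \<in> points M \<and> q \<in> points M \<and> oangle p M K = oangle p M L}"

definition circular_bisector :: "real^4 \<Rightarrow> real^4 \<Rightarrow> ocircle \<Rightarrow> ocircle \<Rightarrow> ocircle" where
  "circular_bisector p q K L = (THE M. M \<in> equiangular_circles p q K L \<and>
     (\<forall>N \<in> equiangular_circles p q K L. oangle p M K \<le> oangle p N K \<and> oangle p M L \<le> oangle p N L))"

text \<open>
  A quadruplet is indexed by the four-element type \<open>4\<close>, so that \<open>{i, j, k, l} = UNIV\<close> means that
  \<open>i, j, k, l\<close> are the four distinct indices.  \<open>Gam P i j k l\<close> is the bisector through
  \<open>P i\<close> and \<open>P j\<close>.
\<close>

definition Gam :: "(4 \<Rightarrow> real^4) \<Rightarrow> 4 \<Rightarrow> 4 \<Rightarrow> 4 \<Rightarrow> 4 \<Rightarrow> ocircle" where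
  "Gam P i j k l =
     circular_bisector (P i) (P j) (circle3 (P i) (P j) (P k)) (circle3 (P i) (P j) (P l))"

definition dual :: "(4 \<Rightarrow> real^4) \<Rightarrow> (4 \<Rightarrow> real^4)" where
  "dual P i = (THE X. \<forall>j k l. {i, j, k, l} = UNIV \<longrightarrow>
     points (Gam P i j k l) \<inter> points (Gam P i k j l) \<inter> points (Gam P i l j k) = {P i, X})"

end

theory Submission
  imports Defs
begin

text \<open>
  Stereographic projection from \<open>P i\<close> turns circles through \<open>P i\<close> into lines and bisecting circles
  into interior angle bisectors, so the dual point of \<open>P i\<close> is the point that projects to the incenter
  of the triangle formed by the projections of the other three points (\<open>dual_eqI\<close>).  The barycentric
  coordinates of the incenter are the side lengths, which are, up to a common factor, the products of
  the distances of \<open>P i\<close> to a vertex and between the other two points.  Such a product belongs to a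
  partition of the quadruplet into two pairs and does not single out \<open>i\<close>.

  To exploit this symmetry, attach to each point a light-like vector \<open>x\<^sub>i = (m i *\<^sub>R P i, m i)\<close> of
  Minkowski space.  The positive weights \<open>m\<close> can be chosen such that the Lorentz product of any two of
  these vectors equals that of the other two (\<open>ex_balanced\<close>); this amounts to a Moebius
  transformation to a tetrahedron with congruent faces.  With \<open>s\<close> the sum of the four vectors, the dual
  points are then represented by the light-like vectors \<open>y\<^sub>i = s - 2 x\<^sub>i\<close> (\<open>dual_eq_dual_point\<close>).  Their
  Lorentz products are four times those of the \<open>x\<^sub>i\<close>, so their weights are balanced again
  (\<open>dual_balanced\<close>), and they inherit linear independence, which is what remains of not being
  cocircular (\<open>dual_affinely_independent\<close>).  Hence the same formula gives the second dual.  As the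
  \<open>y\<^sub>i\<close> add up to \<open>2 s\<close>, it is \<open>2 s - 2 y\<^sub>i = 4 x\<^sub>i\<close>, which represents \<open>P i\<close> (\<open>dual_dual_point\<close>).
\<close>

section \<open>Stereographic projection from a point of the sphere\<close>

text \<open>
  Inversion at \<open>p\<close> with squared radius 2, translated so that \<open>p\<close> is the origin.  It maps \<open>S3 - {p}\<close> onto the affine
  hyperplane of all \<open>y\<close> with \<open>y \<bullet> p = -1\<close>, so it is stereographic projection from \<open>p\<close>.
\<close>

definition stereo :: "real^4 \<Rightarrow> real^4 \<Rightarrow> real^4" where
  "stereo p x = (2 / (norm (x - p))\<^sup>2) *\<^sub>R (x - p)"

lemma one_minus_inner:
  fixes x p :: "real^4"
  assumes "p \<in> S3" "x \<in> S3" shows "1 - x \<bullet> p = (norm (x - p))\<^sup>2 / 2"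
  using assms by (simp add: power2_norm_eq_inner inner_diff inner_commute norm_eq_1)

lemma stereo_inner:
  assumes "p \<in> S3" "x \<in> S3" "x \<noteq> p" shows "stereo p x \<bullet> p = -1"
proof -
  have "(x - p) \<bullet> p = - (norm (x - p))\<^sup>2 / 2"
    using one_minus_inner[OF assms(1,2)] assms by (simp add: inner_diff norm_eq_1)
  then show ?thesis using assms by (simp add: stereo_def divide_simps)
qed

lemma stereo_inverse:
  assumes "x \<noteq> p" shows "x = p + (2 / (norm (stereo p x))\<^sup>2) *\<^sub>R stereo p x"
proof -
  have "norm (stereo p x) = 2 / norm (x - p)"
    using assms by (simp add: stereo_def power2_eq_square)
  with assms show ?thesis by (simp add: stereo_def power2_eq_square)
qed

lemma stereo_inject:
  assumes "x \<noteq> p" "y \<noteq> p" "stereo p x = stereo p y" shows "x = y"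
  using stereo_inverse[of x p] stereo_inverse[of y p] assms by metis

text \<open>
  The distortion factor of an inversion.  It turns the side lengths of a projected triangle into
  distances in the sphere.
\<close>

lemma norm_stereo_diff:
  assumes "x \<noteq> p" "y \<noteq> p"
  shows "norm (stereo p x - stereo p y) = 2 * norm (x - y) / (norm (x - p) * norm (y - p))"
proof -
  define a b where "a = x - p" and "b = y - p"
  have n: "norm a \<noteq> 0" "norm b \<noteq> 0" using assms by (auto simp: a_def b_def)
  have xy: "x - y = a - b" by (simp add: a_def b_def)
  have "(norm (stereo p x - stereo p y))\<^sup>2 = (2 * norm (a - b) / (norm a * norm b))\<^sup>2"
    using n unfolding stereo_def a_def[symmetric] b_def[symmetric]
    apply (simp add: power2_norm_eq_inner power_divide power_mult_distrib)
    apply (simp add: inner_diff inner_commute)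
    apply (simp add: dot_square_norm divide_simps)
    done
  then show ?thesis
    by (simp add: xy flip: a_def b_def)
qed

section \<open>Oriented circles as lines in the projection\<close>

text \<open>
  The start of the angular parameter is arbitrary: turning the frame by \<open>s\<close> reparametrises the same
  oriented circle.
\<close>

lemma circle_pt_rotate:
  "circle_pt c r u v (s + t) = circle_pt c r (cos s *\<^sub>R u + sin s *\<^sub>R v) (circle_tan u v s) t"
  by (simp add: circle_pt_def circle_tan_def cos_add sin_add algebra_simps)

lemma circle_tan_rotate:
  "circle_tan u v (s + t) = circle_tan (cos s *\<^sub>R u + sin s *\<^sub>R v) (circle_tan u v s) t"
  by (simp add: circle_tan_def cos_add sin_add algebra_simps)

lemma ocirc_rotate:
  "ocirc c r u v = ocirc c r (cos s *\<^sub>R u + sin s *\<^sub>R v) (circle_tan u v s)"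
proof -
  have "ocirc c r u v = range ((\<lambda>t. (circle_pt c r u v t, circle_tan u v t)) \<circ> (+) s)"
    unfolding ocirc_def using surj_plus[of s] by (metis image_comp)
  then show ?thesis
    by (simp add: ocirc_def comp_def circle_pt_rotate circle_tan_rotate)
qed

lemma circle_frame_rotate:
  assumes "circle_frame r u v"
  shows "circle_frame r (cos s *\<^sub>R u + sin s *\<^sub>R v) (circle_tan u v s)"
proof -
  have "u \<bullet> u = 1" "v \<bullet> v = 1" "u \<bullet> v = 0" "v \<bullet> u = 0" "r > 0"
    using assms by (auto simp: circle_frame_def norm_eq_1 inner_commute)
  then show ?thesis
    by (simp add: circle_frame_def circle_tan_def norm_eq_1 inner_add inner_diff
        flip: power2_eq_square)
qed

text \<open>
  The oriented circle with frame \<open>u, w\<close> and radius \<open>r\<close> that starts at \<open>p\<close> has centre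
  \<open>p - r *\<^sub>R u\<close> and tangent \<open>w\<close> at \<open>p\<close>.  The two inner product conditions say that it lies on the unit
  sphere.
\<close>

definition based_frame :: "real^4 \<Rightarrow> real^4 \<Rightarrow> real \<Rightarrow> real^4 \<Rightarrow> bool" where
  "based_frame p w r u \<longleftrightarrow> p \<in> S3 \<and> circle_frame r u w \<and> p \<bullet> u = r \<and> p \<bullet> w = 0"

lemma points_ocirc: "points (ocirc c r u v) = range (circle_pt c r u v)"
  by (simp add: points_def ocirc_def image_image)

lemma ocirc_on_sphere:
  assumes "circle_frame r u v" "points (ocirc c r u v) \<subseteq> S3"
  shows "c \<bullet> u = 0" "c \<bullet> v = 0" "(c \<bullet> c) + r\<^sup>2 = 1"
proof -
  have uv: "u \<bullet> u = 1" "v \<bullet> v = 1" "u \<bullet> v = 0" "v \<bullet> u = 0" "r > 0"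
    using assms by (auto simp: circle_frame_def norm_eq_1 inner_commute)
  have *: "circle_pt c r u v t \<bullet> circle_pt c r u v t = 1" for t
    using assms(2) by (force simp: points_def ocirc_def norm_eq_1)
  \<comment> \<open>The points at the parameters 0, pi and pi/2 already force the three equations.\<close>
  have 1: "c \<bullet> c + 2 * r * (c \<bullet> u) + r * r = 1"
    using *[of 0] uv by (simp add: circle_pt_def inner_add inner_commute)
  have 2: "c \<bullet> c - 2 * r * (c \<bullet> u) + r * r = 1"
    using *[of pi] uv by (simp add: circle_pt_def inner_add inner_diff inner_commute)
  have 3: "c \<bullet> c + 2 * r * (c \<bullet> v) + r * r = 1"
    using *[of "pi/2"] uv by (simp add: circle_pt_def inner_add inner_commute)
  have "r * (c \<bullet> u) = 0" using 1 2 by linarith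
  then show "c \<bullet> u = 0" using uv by simp
  then show cr: "c \<bullet> c + r\<^sup>2 = 1" using 1 by (simp add: power2_eq_square)
  then have "r * (c \<bullet> v) = 0" using 3 unfolding power2_eq_square by linarith
  then show "c \<bullet> v = 0" using uv by simp
qed

lemma based_normal_form:
  fixes s :: real
  assumes "circle_frame r u v" "points (ocirc c r u v) \<subseteq> S3"
  defines "u' \<equiv> cos s *\<^sub>R u + sin s *\<^sub>R v" and "p \<equiv> circle_pt c r u v s"
  shows "based_frame p (circle_tan u v s) r u'" "c = p - r *\<^sub>R u'"
proof -
  have uv: "u \<bullet> u = 1" "v \<bullet> v = 1" "u \<bullet> v = 0" "v \<bullet> u = 0" "r > 0"
    using assms by (auto simp: circle_frame_def norm_eq_1 inner_commute)
  note c = ocirc_on_sphere[OF assms(1,2)]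
  have "p \<in> S3" using assms(2) by (force simp: points_def ocirc_def p_def)
  moreover have "p \<bullet> u' = r * ((sin s)\<^sup>2 + (cos s)\<^sup>2)"
    using uv c by (simp add: p_def u'_def circle_pt_def inner_add distrib_left power2_eq_square del: sin_cos_squared_add3)
  moreover have "p \<bullet> circle_tan u v s = 0"
    using uv c by (simp add: p_def circle_tan_def circle_pt_def inner_add inner_diff)
  ultimately show "based_frame p (circle_tan u v s) r u'"
    using circle_frame_rotate[OF assms(1), of s] by (simp add: based_frame_def u'_def)
  show "c = p - r *\<^sub>R u'" by (simp add: p_def u'_def circle_pt_def)
qed

lemma ocircle_based:
  assumes "K \<in> ocircles_S3" "(p, w) \<in> K"
  obtains r u where "based_frame p w r u" "K = ocirc (p - r *\<^sub>R u) r u w"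
proof -
  obtain c r u v where K: "K = ocirc c r u v" "circle_frame r u v" "points K \<subseteq> S3"
    using assms(1) by (auto simp: ocircles_S3_def)
  obtain s where s: "p = circle_pt c r u v s" "w = circle_tan u v s"
    using assms(2) by (auto simp: K ocirc_def)
  show thesis
    using that based_normal_form[of r u v c s] K s ocirc_rotate[of c r u v s] by metis
qed

lemma based_ocirc:
  assumes "based_frame p w r u"
  shows "ocirc (p - r *\<^sub>R u) r u w \<in> ocircles_S3" "(p, w) \<in> ocirc (p - r *\<^sub>R u) r u w"
proof -
  have f: "p \<bullet> p = 1" "u \<bullet> u = 1" "w \<bullet> w = 1" "u \<bullet> w = 0" "w \<bullet> u = 0" "p \<bullet> u = r" "u \<bullet> p = r" "p \<bullet> w = 0" "w \<bullet> p = 0"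
    using assms by (auto simp: based_frame_def circle_frame_def norm_eq_1 inner_commute)
  have "circle_pt (p - r *\<^sub>R u) r u w t \<bullet> circle_pt (p - r *\<^sub>R u) r u w t = 1 - r\<^sup>2 + r\<^sup>2 * ((sin t)\<^sup>2 + (cos t)\<^sup>2)" for t
    using f by (simp add: circle_pt_def inner_add inner_diff inner_commute distrib_left power2_eq_square del: sin_cos_squared_add3)
  then have "points (ocirc (p - r *\<^sub>R u) r u w) \<subseteq> S3"
    by (auto simp: points_def ocirc_def norm_eq_1)
  then show "ocirc (p - r *\<^sub>R u) r u w \<in> ocircles_S3"
    using assms by (auto simp: ocircles_S3_def based_frame_def)
  show "(p, w) \<in> ocirc (p - r *\<^sub>R u) r u w"
    by (auto simp: ocirc_def circle_pt_def circle_tan_def intro!: range_eqI[of _ _ 0])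
qed

text \<open>
  With the half-angle parameter \<open>a\<close>, the projection of a circle through the centre of projection is a
  line with direction \<open>w\<close>, with position proportional to \<open>tan a\<close>.  Since \<open>a\<close> decreases as one moves along
  the oriented circle, the line is run through against its direction \<open>w\<close>.
\<close>

lemma stereo_circle_pt:
  assumes "based_frame p w r u" "-pi/2 < a" "a < pi/2"
  defines "x \<equiv> circle_pt (p - r *\<^sub>R u) r u w (pi - 2 * a)"
  shows "x \<noteq> p" "stereo p x = (1/r) *\<^sub>R (tan a *\<^sub>R w - u)"
proof -
  have f: "u \<bullet> u = 1" "w \<bullet> w = 1" "u \<bullet> w = 0" "w \<bullet> u = 0" "r > 0"
    using assms(1) by (auto simp: based_frame_def circle_frame_def norm_eq_1 inner_commute)
  have c: "cos a > 0" using assms cos_gt_zero_pi[of a] by simp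
  have x: "x - p = (2 * r * cos a) *\<^sub>R (sin a *\<^sub>R w - cos a *\<^sub>R u)"
    unfolding x_def circle_pt_def cos_diff sin_diff sin_double cos_double_cos
    by (simp add: algebra_simps power2_eq_square)
  have "(norm (sin a *\<^sub>R w - cos a *\<^sub>R u))\<^sup>2 = 1"
    unfolding power2_norm_eq_inner using f by (simp add: inner_diff flip: power2_eq_square)
  then have n: "(norm (x - p))\<^sup>2 = (2 * r * cos a)\<^sup>2"
    unfolding x by (simp add: power_mult_distrib)
  then show "x \<noteq> p" using c f by auto
  show "stereo p x = (1/r) *\<^sub>R (tan a *\<^sub>R w - u)"
    unfolding stereo_def n unfolding x using c f
    by (simp add: power2_eq_square tan_def scaleR_diff_right divide_simps)
qed

text \<open>
  Every real is the tangent of a half-angle, so the circle without \<open>p\<close> covers the whole line.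
\<close>

lemma mem_points_based:
  assumes "based_frame p w r u" 
  shows "x \<in> points (ocirc (p - r *\<^sub>R u) r u w) \<longleftrightarrow>
     x = p \<or> x \<noteq> p \<and> (\<exists>\<tau>. stereo p x = \<tau> *\<^sub>R w - (1/r) *\<^sub>R u)" (is "?L \<longleftrightarrow> ?R")
proof -
  have r: "r > 0" using assms by (auto simp: based_frame_def circle_frame_def)
  let ?c = "circle_pt (p - r *\<^sub>R u) r u w"
  have pts: "?L \<longleftrightarrow> (\<exists>t. x = ?c t)" by (auto simp: points_ocirc)
  show ?thesis
  proof
    assume ?L
    then obtain t where t: "x = ?c t" using pts by auto
    obtain t' where t': "0 \<le> t'" "t' < 2 * pi" "cos t = cos t'" "sin t = sin t'"
      using sincos_total_2pi[of "cos t" "sin t"] by auto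
    then have x: "x = ?c t'" by (simp add: t circle_pt_def)
    show ?R
    proof (cases "t' = 0")
      case True then show ?thesis by (simp add: x circle_pt_def)
    next
      case False
      \<comment> \<open>The half-angle parameter, which decreases from pi/2 to -pi/2 in the course of one turn.\<close>
      define a where "a = (pi - t') / 2"
      have a: "-pi/2 < a" "a < pi/2" "t' = pi - 2*a" using t' False by (auto simp: a_def field_simps)
      have "stereo p x = (tan a / r) *\<^sub>R w - (1/r) *\<^sub>R u"
        using stereo_circle_pt(2)[OF assms a(1,2)] by (simp add: x a scaleR_diff_right)
      then show ?thesis by blast
    qed
  next
    assume ?R
    then consider "x = p" | \<tau> where "x \<noteq> p" "stereo p x = \<tau> *\<^sub>R w - (1/r) *\<^sub>R u" by blast
    then show ?L
    proof cases
      case 1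
      then have "x = ?c 0" by (simp add: circle_pt_def)
      then show ?thesis using pts by blast
    next
      case 2
      define a where "a = arctan (r * \<tau>)"
      have a: "-pi/2 < a" "a < pi/2" "tan a = r * \<tau>"
        using arctan[of "r * \<tau>"] by (auto simp: a_def)
      have "x = ?c (pi - 2 * a)"
        using stereo_circle_pt[OF assms a(1,2)] 2 r a(3)
        by (intro stereo_inject[of x p]) (auto simp: scaleR_diff_right)
      then show ?thesis using pts by blast
    qed
  qed
qed

text \<open>
  The image line passes through the projection of \<open>q\<close> and has direction \<open>w\<close>, and the foot of the
  perpendicular from the origin to it is \<open>- u / r\<close>.
\<close>

lemma based_unique:
  assumes "based_frame p w r u" "based_frame p w r' u'" "q \<noteq> p"
    and "q \<in> points (ocirc (p - r *\<^sub>R u) r u w)" "q \<in> points (ocirc (p - r' *\<^sub>R u') r' u' w)"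
  shows "r = r'" "u = u'"
proof -
  have f: "u \<bullet> w = 0" "u' \<bullet> w = 0" "w \<bullet> w = 1" "norm u = 1" "norm u' = 1" "r > 0" "r' > 0"
    using assms(1,2) by (auto simp: based_frame_def circle_frame_def norm_eq_1)
  obtain \<tau> \<tau>' where \<tau>: "stereo p q = \<tau> *\<^sub>R w - (1/r) *\<^sub>R u" "stereo p q = \<tau>' *\<^sub>R w - (1/r') *\<^sub>R u'"
    using assms mem_points_based[OF assms(1), of q] mem_points_based[OF assms(2), of q] by auto
  have "stereo p q \<bullet> w = \<tau>" using f by (simp add: \<tau>(1) inner_diff)
  moreover have "stereo p q \<bullet> w = \<tau>'" using f by (simp add: \<tau>(2) inner_diff)
  ultimately have e: "(1/r) *\<^sub>R u = (1/r') *\<^sub>R u'" using \<tau> by auto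
  then have "norm ((1/r) *\<^sub>R u) = norm ((1/r') *\<^sub>R u')" by simp
  then show "r = r'" using f by simp
  with e f show "u = u'" by simp
qed

lemma ocircle_eqI:
  assumes "K \<in> ocircles_S3" "L \<in> ocircles_S3" "(p, w) \<in> K" "(p, w) \<in> L"
    and "q \<noteq> p" "q \<in> points K" "q \<in> points L"
  shows "K = L"
proof -
  obtain r u where 1: "based_frame p w r u" "K = ocirc (p - r *\<^sub>R u) r u w"
    using ocircle_based assms by metis
  obtain r' u' where 2: "based_frame p w r' u'" "L = ocirc (p - r' *\<^sub>R u') r' u' w"
    using ocircle_based assms by metis
  show ?thesis using based_unique[OF 1(1) 2(1) assms(5)] assms 1 2 by auto
qed

lemma ocircle_tangent_unit:
  assumes "K \<in> ocircles_S3" "(p, w) \<in> K"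
  shows "norm w = 1" "p \<bullet> w = 0" "p \<in> S3"
  using ocircle_based[OF assms] by (auto simp: based_frame_def circle_frame_def)

lemma ocircle_points_iff:
  assumes "K \<in> ocircles_S3" "(p, w) \<in> K" "q \<in> points K" "q \<noteq> p"
  shows "x \<in> points K \<longleftrightarrow> x = p \<or> x \<noteq> p \<and> (\<exists>\<tau>. stereo p x = stereo p q + \<tau> *\<^sub>R w)"
proof -
  obtain r u where 1: "based_frame p w r u" "K = ocirc (p - r *\<^sub>R u) r u w"
    using ocircle_based assms by metis
  obtain \<sigma> where q: "stereo p q = \<sigma> *\<^sub>R w - (1/r) *\<^sub>R u"
    using mem_points_based[OF 1(1), of q] 1 assms by auto
  have "(\<exists>\<tau>. stereo p x = \<tau> *\<^sub>R w - (1/r) *\<^sub>R u) \<longleftrightarrow> (\<exists>\<tau>. stereo p x = stereo p q + \<tau> *\<^sub>R w)"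
    unfolding q
  proof safe
    fix \<tau> assume "stereo p x = \<tau> *\<^sub>R w - (1/r) *\<^sub>R u"
    then show "\<exists>\<tau>. stereo p x = \<sigma> *\<^sub>R w - (1/r) *\<^sub>R u + \<tau> *\<^sub>R w"
      by (intro exI[of _ "\<tau> - \<sigma>"]) (simp add: algebra_simps)
  next
    fix \<tau> assume "stereo p x = \<sigma> *\<^sub>R w - (1/r) *\<^sub>R u + \<tau> *\<^sub>R w"
    then show "\<exists>\<tau>. stereo p x = \<tau> *\<^sub>R w - (1/r) *\<^sub>R u"
      by (intro exI[of _ "\<sigma> + \<tau>"]) (simp add: algebra_simps)
  qed
  then show ?thesis using mem_points_based[OF 1(1), of x] 1 by auto
qed

text \<open>
  The foot of the perpendicular from the origin to the line through \<open>stereo p q\<close> with direction \<open>w\<close>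
  is \<open>- k\<close>, and the circle has to have \<open>u / r = k\<close>.  It is nonzero because the line lies in the
  hyperplane of all \<open>y\<close> with \<open>y \<bullet> p = -1\<close>, which misses the origin.
\<close>

lemma ocircle_through:
  assumes "p \<in> S3" "q \<in> S3" "q \<noteq> p" "norm w = 1" "p \<bullet> w = 0"
  obtains r u where "based_frame p w r u" "q \<in> points (ocirc (p - r *\<^sub>R u) r u w)"
proof -
  define y where "y = stereo p q"
  define k where "k = (y \<bullet> w) *\<^sub>R w - y"
  have pk: "p \<bullet> k = 1" using stereo_inner[OF assms(1-3)] assms
    by (simp add: k_def y_def inner_diff inner_commute)
  then have k0: "norm k > 0" by auto
  have kw: "k \<bullet> w = 0" using assms by (simp add: k_def inner_diff norm_eq_1)
  define r u where "r = 1 / norm k" and "u = r *\<^sub>R k"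
  have b: "based_frame p w r u" using assms pk k0 kw
    by (simp add: based_frame_def circle_frame_def r_def u_def)
  have "y = (y \<bullet> w) *\<^sub>R w - (1/r) *\<^sub>R u" using k0 by (simp add: r_def u_def k_def)
  then show thesis using that b mem_points_based[OF b, of q] assms by (auto simp: y_def)
qed

lemma tangent_at_eq:
  assumes "K \<in> ocircles_S3" "(p, w) \<in> K" shows "tangent_at K p = w"
proof -
  obtain r u where 1: "based_frame p w r u" "K = ocirc (p - r *\<^sub>R u) r u w"
    using ocircle_based assms by metis
  have f: "u \<bullet> u = 1" "w \<bullet> w = 1" "u \<bullet> w = 0" "w \<bullet> u = 0" "r > 0"
    using 1 by (auto simp: based_frame_def circle_frame_def norm_eq_1 inner_commute)
  show ?thesis unfolding tangent_at_def
  proof (rule the_equality)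
    fix w' assume "(p, w') \<in> K"
    then obtain t where "(p, w') = (circle_pt (p - r *\<^sub>R u) r u w t, circle_tan u w t)"
      unfolding 1(2) ocirc_def by (rule rangeE)
    then have t: "circle_pt (p - r *\<^sub>R u) r u w t = p" "w' = circle_tan u w t"
      by simp_all
    have e: "r *\<^sub>R ((cos t - 1) *\<^sub>R u + sin t *\<^sub>R w) = 0" using t(1) by (simp add: circle_pt_def algebra_simps)
    have "(r *\<^sub>R ((cos t - 1) *\<^sub>R u + sin t *\<^sub>R w)) \<bullet> u = 0" "(r *\<^sub>R ((cos t - 1) *\<^sub>R u + sin t *\<^sub>R w)) \<bullet> w = 0"
      unfolding e by auto
    then have "cos t = 1" "sin t = 0" using f by (auto simp: inner_add)
    then show "w' = w" by (simp add: t circle_tan_def)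
  qed (use assms in auto)
qed

lemma points_tangent:
  assumes "K \<in> ocircles_S3" "p \<in> points K"
  shows "(p, tangent_at K p) \<in> K"
  using assms tangent_at_eq by (force simp: points_def)

section \<open>Circles through three points\<close>

lemma norm_scaleR_sgn:
  fixes x :: "'a::real_normed_vector"
  shows "norm x *\<^sub>R sgn x = x"
  by (cases "x = 0") (simp_all add: sgn_div_norm)

lemma sgn_pos_scale:
  fixes w :: "'a::real_normed_vector"
  assumes "y = c *\<^sub>R w" "c > 0" "norm w = 1" shows "sgn y = w"
  using assms by (simp add: sgn_scaleR) (simp add: sgn_div_norm)

text \<open>
  The orientation condition in the definition of \<open>circle3\<close>.
\<close>

definition in_cyclic_order :: "ocircle \<Rightarrow> real^4 \<Rightarrow> real^4 \<Rightarrow> real^4 \<Rightarrow> bool" where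
  "in_cyclic_order K p q s \<longleftrightarrow> (\<exists>c r u v t1 t2 t3. circle_frame r u v \<and> K = ocirc c r u v \<and>
        t1 < t2 \<and> t2 < t3 \<and> t3 < t1 + 2 * pi \<and>
        circle_pt c r u v t1 = p \<and> circle_pt c r u v t2 = q \<and> circle_pt c r u v t3 = s)"

text \<open>
  On the image line of the circle, \<open>q\<close> comes before \<open>s\<close> in the order of travel, which is opposite to
  the tangent.  Hence the tangent at \<open>p\<close> points from the projection of \<open>s\<close> to that of \<open>q\<close>.
\<close>

lemma in_cyclic_order_imp:
  assumes "K \<in> ocircles_S3" "in_cyclic_order K p q s"
  shows "(p, sgn (stereo p q - stereo p s)) \<in> K" "q \<noteq> p" "q \<in> points K" "s \<in> points K"
proof -
  obtain c r u v t1 t2 t3 where f: "circle_frame r u v" and K: "K = ocirc c r u v" and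
    t: "t1 < t2" "t2 < t3" "t3 < t1 + 2 * pi" and
    pt: "circle_pt c r u v t1 = p" "circle_pt c r u v t2 = q" "circle_pt c r u v t3 = s"
    using assms(2) unfolding in_cyclic_order_def by auto
  have sub: "points (ocirc c r u v) \<subseteq> S3"
    using assms(1) by (auto simp: K ocircles_S3_def)
  define w where "w = circle_tan u v t1"
  define u' where "u' = cos t1 *\<^sub>R u + sin t1 *\<^sub>R v"
  have b: "based_frame p w r u'" and c: "c = p - r *\<^sub>R u'"
    using based_normal_form[OF f sub, of t1] by (simp_all add: pt w_def u'_def)
  have K': "K = ocirc (p - r *\<^sub>R u') r u' w" using ocirc_rotate[of c r u v t1] by (simp add: K c w_def u'_def)
  have r: "r > 0" "norm w = 1" using b by (auto simp: based_frame_def circle_frame_def)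
  define a2 a3 where "a2 = (pi - (t2 - t1)) / 2" and "a3 = (pi - (t3 - t1)) / 2"
  have a: "-pi/2 < a2" "a2 < pi/2" "-pi/2 < a3" "a3 < pi/2" "a3 < a2"
    using t by (auto simp: a2_def a3_def)
  have "circle_pt c r u v (t1 + (t2 - t1)) = q" "circle_pt c r u v (t1 + (t3 - t1)) = s"
    using pt by auto
  then have "circle_pt c r u' w (t2 - t1) = q" "circle_pt c r u' w (t3 - t1) = s"
    unfolding circle_pt_rotate w_def u'_def by auto
  moreover have "t2 - t1 = pi - 2 * a2" "t3 - t1 = pi - 2 * a3" by (simp_all add: a2_def a3_def field_simps)
  ultimately have qs: "q = circle_pt (p - r *\<^sub>R u') r u' w (pi - 2 * a2)" "s = circle_pt (p - r *\<^sub>R u') r u' w (pi - 2 * a3)"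
    using c by auto
  note q = stereo_circle_pt[OF b a(1,2), folded qs]
  note s = stereo_circle_pt[OF b a(3,4), folded qs]
  have "stereo p q - stereo p s = ((tan a2 - tan a3) / r) *\<^sub>R w"
    unfolding q s by (simp add: algebra_simps diff_divide_distrib)
  moreover have "tan a3 < tan a2" using a by (intro tan_monotone) auto
  ultimately have "sgn (stereo p q - stereo p s) = w"
    using r by (intro sgn_pos_scale[of _ "(tan a2 - tan a3) / r"]) auto
  then show "(p, sgn (stereo p q - stereo p s)) \<in> K" using based_ocirc(2)[OF b] K' by simp
  show "q \<noteq> p" using q by auto
  show "q \<in> points K" "s \<in> points K" using pt by (auto simp: K points_ocirc)
qed

lemma ex_in_cyclic_order:
  assumes "p \<in> S3" "q \<in> S3" "s \<in> S3" "q \<noteq> p" "s \<noteq> p" "s \<noteq> q"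
  shows "\<exists>K \<in> ocircles_S3. in_cyclic_order K p q s"
proof -
  define w where "w = sgn (stereo p q - stereo p s)"
  have ne: "stereo p q - stereo p s \<noteq> 0" using stereo_inject[of q p s] assms by auto
  have d: "stereo p q - stereo p s = norm (stereo p q - stereo p s) *\<^sub>R w"
    by (simp add: w_def norm_scaleR_sgn)
  have w: "norm w = 1" "p \<bullet> w = 0"
    using ne stereo_inner[of p q] stereo_inner[of p s] assms
    by (auto simp: w_def norm_sgn sgn_div_norm inner_diff inner_commute)
  obtain r u where b: "based_frame p w r u" and qK: "q \<in> points (ocirc (p - r *\<^sub>R u) r u w)"
    using ocircle_through[of p q w] assms w by metis
  let ?K = "ocirc (p - r *\<^sub>R u) r u w"
  have r: "r > 0" "circle_frame r u w" using b by (auto simp: based_frame_def circle_frame_def)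
  obtain \<tau> where q: "stereo p q = \<tau> *\<^sub>R w - (1/r) *\<^sub>R u"
    using mem_points_based[OF b, of q] qK assms by auto
  define \<sigma> where "\<sigma> = \<tau> - norm (stereo p q - stereo p s)"
  have s: "stereo p s = \<sigma> *\<^sub>R w - (1/r) *\<^sub>R u"
    using d by (simp add: \<sigma>_def q algebra_simps)
  have "\<sigma> < \<tau>" using ne by (simp add: \<sigma>_def)
  define a b where "a = arctan (r * \<tau>)" and "b = arctan (r * \<sigma>)"
  have a: "-pi/2 < a" "a < pi/2" "tan a = r * \<tau>" using arctan[of "r * \<tau>"] by (auto simp: a_def)
  have b': "-pi/2 < b" "b < pi/2" "tan b = r * \<sigma>" using arctan[of "r * \<sigma>"] by (auto simp: b_def)
  have "b < a" using r \<open>\<sigma> < \<tau>\<close> by (simp add: a_def b_def arctan_less_iff)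
  have "q = circle_pt (p - r *\<^sub>R u) r u w (pi - 2 * a)"
    using stereo_circle_pt[OF b a(1,2)] q r assms a(3)
    by (intro stereo_inject[of q p]) (auto simp: scaleR_diff_right)
  moreover have "s = circle_pt (p - r *\<^sub>R u) r u w (pi - 2 * b)"
    using stereo_circle_pt[OF b b'(1,2)] s r assms b'(3)
    by (intro stereo_inject[of s p]) (auto simp: scaleR_diff_right)
  moreover have "p = circle_pt (p - r *\<^sub>R u) r u w 0" by (simp add: circle_pt_def)
  moreover have "0 < pi - 2 * a" "pi - 2 * a < pi - 2 * b" "pi - 2 * b < 0 + 2 * pi" using a b' \<open>b < a\<close> by auto
  ultimately have "in_cyclic_order ?K p q s"
    unfolding in_cyclic_order_def using r(2) by metis
  then show ?thesis using based_ocirc(1)[OF b] by blast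
qed

lemma circle3_props:
  assumes "p \<in> S3" "q \<in> S3" "s \<in> S3" "q \<noteq> p" "s \<noteq> p" "s \<noteq> q"
  shows "circle3 p q s \<in> ocircles_S3"
    "(p, sgn (stereo p q - stereo p s)) \<in> circle3 p q s"
    "q \<in> points (circle3 p q s)" "s \<in> points (circle3 p q s)"
proof -
  have "\<exists>!K. K \<in> ocircles_S3 \<and> in_cyclic_order K p q s"
    using ex_in_cyclic_order[OF assms] in_cyclic_order_imp ocircle_eqI by (metis (no_types, lifting))
  from theI'[OF this] have "circle3 p q s \<in> ocircles_S3 \<and> in_cyclic_order (circle3 p q s) p q s"
    by (simp add: circle3_def in_cyclic_order_def)
  then show "circle3 p q s \<in> ocircles_S3"
    "(p, sgn (stereo p q - stereo p s)) \<in> circle3 p q s"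
    "q \<in> points (circle3 p q s)" "s \<in> points (circle3 p q s)"
    using in_cyclic_order_imp by metis+
qed

section \<open>Circular angle bisectors\<close>

lemma sgn_add_equal_inner:
  fixes a b :: "'a::real_inner"
  assumes "norm a = 1" "norm b = 1"
  shows "sgn (a + b) \<bullet> a = sgn (a + b) \<bullet> b"
proof -
  have "(a + b) \<bullet> a = (a + b) \<bullet> b" using assms by (simp add: inner_add inner_commute norm_eq_1)
  then show ?thesis by (simp add: sgn_div_norm)
qed

text \<open>
  A vector \<open>w\<close> with \<open>w \<bullet> a = w \<bullet> b\<close> satisfies \<open>w \<bullet> a = w \<bullet> (a + b) / 2\<close>, and among unit vectors this is
  largest exactly in the direction of \<open>a + b\<close>.
\<close>

lemma sgn_bisector_optimal:
  fixes a b w :: "'a::real_inner"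
  assumes "norm a = 1" "norm b = 1" "norm w = 1" "a + b \<noteq> 0" "w \<bullet> a = w \<bullet> b"
  defines "m \<equiv> sgn (a + b)"
  shows "w \<bullet> a \<le> m \<bullet> a" "w \<bullet> a = m \<bullet> a \<Longrightarrow> w = m"
proof -
  define n where "n = norm (a + b)"
  have n: "n > 0" using assms by (simp add: n_def)
  have m: "norm m = 1" using assms by (simp add: norm_sgn)
  have ab: "a + b = n *\<^sub>R m" by (simp add: m_def n_def norm_scaleR_sgn)
  have ma: "m \<bullet> a = m \<bullet> b" unfolding m_def by (rule sgn_add_equal_inner[OF assms(1,2)])
  have "m \<bullet> (a + b) = n" using m by (simp add: ab norm_eq_1)
  then have 1: "m \<bullet> a = n / 2" using ma by (simp add: inner_add)
  have "w \<bullet> (a + b) = n * (w \<bullet> m)" by (simp add: ab)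
  then have 2: "w \<bullet> a = n / 2 * (w \<bullet> m)" using assms(5) by (simp add: inner_add)
  have 3: "(norm (w - m))\<^sup>2 = 2 - 2 * (w \<bullet> m)" using m assms(3)
    by (simp add: power2_norm_eq_inner inner_diff inner_commute norm_eq_1)
  then have "w \<bullet> m \<le> 1" using zero_le_power2[of "norm (w - m)"] by linarith
  then show "w \<bullet> a \<le> m \<bullet> a" using n unfolding 1 2 by simp
  assume "w \<bullet> a = m \<bullet> a"
  then have "w \<bullet> m = 1" using n unfolding 1 2 by simp
  then show "w = m" using 3 by simp
qed

lemma abs_inner_unit:
  fixes a b :: "'a::real_inner"
  assumes "norm a = 1" "norm b = 1" shows "\<bar>a \<bullet> b\<bar> \<le> 1"
  using Cauchy_Schwarz_ineq2[of a b] assms by simp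

text \<open>
  Circles through \<open>p\<close> and \<open>q\<close> correspond to unit tangents at \<open>p\<close>, and the angle is the decreasing
  function arccos of an inner product; so the minimising circle is the one with tangent in the
  direction \<open>a + b\<close>.
\<close>

lemma circular_bisector_props:
  assumes K: "K \<in> ocircles_S3" "(p, a) \<in> K" "q \<in> points K"
    and L: "L \<in> ocircles_S3" "(p, b) \<in> L" "q \<in> points L"
    and ne: "q \<noteq> p" "a + b \<noteq> 0"
  shows "circular_bisector p q K L \<in> ocircles_S3"
    "(p, sgn (a + b)) \<in> circular_bisector p q K L" "q \<in> points (circular_bisector p q K L)"
proof -
  let ?E = "equiangular_circles p q K L"
  define m where "m = sgn (a + b)"
  note a = ocircle_tangent_unit[OF K(1,2)] note b = ocircle_tangent_unit[OF L(1,2)]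
  have m: "norm m = 1" "p \<bullet> m = 0" using a b ne by (auto simp: m_def norm_sgn) (simp add: sgn_div_norm inner_add)
  have q: "q \<in> S3" using K ocircle_tangent_unit points_tangent by blast
  obtain r u where bs: "based_frame p m r u" and qM: "q \<in> points (ocirc (p - r *\<^sub>R u) r u m)"
    using ocircle_through[OF a(3) q ne(1) m] by metis
  define M where "M = ocirc (p - r *\<^sub>R u) r u m"
  have M: "M \<in> ocircles_S3" "(p, m) \<in> M" "q \<in> points M"
    using based_ocirc[OF bs] qM by (auto simp: M_def)
  have ang: "oangle p N K = arccos (w \<bullet> a)" "oangle p N L = arccos (w \<bullet> b)" if "N \<in> ocircles_S3" "(p, w) \<in> N" for N w
    using that K L by (auto simp: oangle_def tangent_at_eq)
  have opt0: "m \<bullet> a = m \<bullet> b" unfolding m_def by (rule sgn_add_equal_inner[OF a(1) b(1)])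
  have ME: "M \<in> ?E" using M ang[OF M(1,2)] opt0 by (force simp: equiangular_circles_def points_def)
  have E: "\<exists>w. (p, w) \<in> N \<and> norm w = 1 \<and> w \<bullet> a = w \<bullet> b \<and> w \<bullet> a \<le> m \<bullet> a \<and> (w \<bullet> a = m \<bullet> a \<longrightarrow> w = m)"
    if N: "N \<in> ?E" for N
  proof -
    have N': "N \<in> ocircles_S3" "p \<in> points N" using N by (auto simp: equiangular_circles_def)
    note w = points_tangent[OF N']
    note w' = ocircle_tangent_unit[OF N'(1) w]
    have "arccos (tangent_at N p \<bullet> a) = arccos (tangent_at N p \<bullet> b)"
      using N ang[OF N'(1) w] by (auto simp: equiangular_circles_def)
    then have "tangent_at N p \<bullet> a = tangent_at N p \<bullet> b"
      using arccos_eq_iff[OF conjI[OF abs_inner_unit[OF w'(1) a(1)] abs_inner_unit[OF w'(1) b(1)]]] by simp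
    then show ?thesis using w w'(1) sgn_bisector_optimal[OF a(1) b(1) w'(1) ne(2)] unfolding m_def by blast
  qed
  have "circular_bisector p q K L = M"
    unfolding circular_bisector_def
  proof (rule the_equality, intro conjI ballI)
    show "M \<in> ?E" by (fact ME)
    fix N assume N: "N \<in> ?E"
    then obtain w where w: "(p, w) \<in> N" "norm w = 1" "w \<bullet> a = w \<bullet> b" "w \<bullet> a \<le> m \<bullet> a" using E by blast
    have "arccos (m \<bullet> a) \<le> arccos (w \<bullet> a)"
      using arccos_le_mono[OF abs_inner_unit[OF m(1) a(1)] abs_inner_unit[OF w(2) a(1)]] w by simp
    then show "oangle p M K \<le> oangle p N K" "oangle p M L \<le> oangle p N L"
      using ang[OF M(1,2)] ang[of N w] N w opt0 by (auto simp: equiangular_circles_def)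
  next
    fix N assume N: "N \<in> ?E \<and> (\<forall>N' \<in> ?E. oangle p N K \<le> oangle p N' K \<and> oangle p N L \<le> oangle p N' L)"
    then obtain w where w: "(p, w) \<in> N" "norm w = 1" "w \<bullet> a \<le> m \<bullet> a" "w \<bullet> a = m \<bullet> a \<longrightarrow> w = m" using E by blast
    have N': "N \<in> ocircles_S3" "q \<in> points N" using N by (auto simp: equiangular_circles_def)
    have "arccos (w \<bullet> a) \<le> arccos (m \<bullet> a)"
      using N ME ang[OF M(1,2)] ang[OF N'(1) w(1)] by auto
    then have "m \<bullet> a \<le> w \<bullet> a"
      using arccos_le_mono[OF abs_inner_unit[OF w(2) a(1)] abs_inner_unit[OF m(1) a(1)]] by simp
    then have "w = m" using w by auto
    then show "N = M" using ocircle_eqI[OF N'(1) M(1)] w(1) M ne(1) N' by blast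
  qed
  then show "circular_bisector p q K L \<in> ocircles_S3"
    "(p, sgn (a + b)) \<in> circular_bisector p q K L" "q \<in> points (circular_bisector p q K L)"
    using M by (auto simp: m_def)
qed

section \<open>Quadruplets that are not cocircular\<close>

lemma four_indices:
  fixes i j k l :: 4
  assumes "{i, j, k, l} = UNIV"
  shows "i \<noteq> j" "i \<noteq> k" "i \<noteq> l" "j \<noteq> k" "j \<noteq> l" "k \<noteq> l"
proof -
  have "card {i, j, k, l} = 4" using assms by simp
  then show "i \<noteq> j" "i \<noteq> k" "i \<noteq> l" "j \<noteq> k" "j \<noteq> l" "k \<noteq> l"
    by (auto simp: card_insert_if split: if_splits)
qed

lemma sum_four_indices:
  fixes i j k l :: 4 and f :: "4 \<Rightarrow> 'a::comm_monoid_add"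
  assumes "{i, j, k, l} = UNIV"
  shows "sum f UNIV = f i + f j + f k + f l"
  using four_indices[OF assms] by (simp flip: assms add: add.assoc)

lemma ex_four_indices:
  obtains j k l where "{i, j, k, l} = (UNIV :: 4 set)"
proof -
  have "card (UNIV - {i} :: 4 set) = 3" by (simp add: card_Diff_singleton)
  then obtain j k l where "UNIV - {i} = {j, k, l}" unfolding card_3_iff by blast
  then have "{i, j, k, l} = UNIV" by auto
  then show thesis using that by blast
qed

text \<open>
  Formulated for families rather than sets, so that repeated points count as a dependence.
\<close>

definition affinely_independent :: "('i::finite \<Rightarrow> 'a::real_vector) \<Rightarrow> bool" where
  "affinely_independent P \<longleftrightarrow>
     (\<forall>\<mu>. (\<Sum>i\<in>UNIV. \<mu> i) = 0 \<and> (\<Sum>i\<in>UNIV. \<mu> i *\<^sub>R P i) = 0 \<longrightarrow> (\<forall>i. \<mu> i = 0))"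

lemma affinely_independent_inj:
  assumes "affinely_independent P" shows "inj P"
proof (rule injI, rule ccontr)
  fix i j assume ij: "P i = P j" "i \<noteq> j"
  let ?\<mu> = "\<lambda>x. (if x = i then 1 else 0) - (if x = j then 1 else 0) :: real"
  have "(\<Sum>x\<in>UNIV. ?\<mu> x) = 0" by (simp add: sum_subtractf)
  moreover have "(\<Sum>x\<in>UNIV. ?\<mu> x *\<^sub>R P x) = 0"
    by (simp add: scaleR_diff_left sum_subtractf if_distrib[of "\<lambda>c. c *\<^sub>R _"] ij(1) cong: if_cong)
  ultimately have "?\<mu> i = 0" using assms unfolding affinely_independent_def by blast
  then show False using ij(2) by simp
qed

lemma three_points_cocircular:
  assumes "p \<in> S3" "q \<in> S3" "s \<in> S3" "q \<noteq> p" "s \<noteq> p" "s \<noteq> q"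
  shows "cocircular {p, q, s}"
  using circle3_props[OF assms] unfolding cocircular_def points_def by force

lemma infinite_S3: "infinite S3"
proof
  assume "finite S3"
  moreover have "connected S3" by (simp add: connected_sphere)
  moreover have "axis 1 1 \<in> S3" "axis 2 1 \<in> S3" "axis 1 1 \<noteq> (axis 2 1 :: real^4)" by (auto simp: axis_eq_axis)
  ultimately show False using connected_finite_iff_sing[of S3] by (metis empty_iff singletonD)
qed

text \<open>
  At most three points of the sphere can be completed to three distinct ones, which lie on a circle.
\<close>

lemma not_cocircular_inj:
  fixes P :: "4 \<Rightarrow> real^4"
  assumes P: "\<And>i. P i \<in> S3" and nc: "\<not> cocircular (range P)"
  shows "inj P"
proof (rule ccontr)
  assume "\<not> inj P"
  then have "card (range P) \<noteq> card (UNIV :: 4 set)" using eq_card_imp_inj_on[of "UNIV :: 4 set" P] by auto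
  moreover have "card (range P) \<le> card (UNIV :: 4 set)" by (rule card_image_le) simp
  ultimately have c: "card (range P) \<le> 3" by simp
  obtain C where C: "finite C" "card C = 3" "C \<subseteq> S3"
    using infinite_arbitrarily_large[OF infinite_S3] by blast
  have "3 \<le> card (range P \<union> C)" using C card_mono[of "range P \<union> C" C] by simp
  then obtain T where T: "range P \<subseteq> T" "T \<subseteq> range P \<union> C" "card T = 3"
    using exists_subset_between[OF c, of "range P \<union> C"] C by auto
  obtain p q s where pqs: "T = {p, q, s}" "p \<noteq> q" "q \<noteq> s" "p \<noteq> s" using T by (auto simp: card_3_iff)
  have "T \<subseteq> S3" using T(2) C(3) P by blast
  then have "cocircular T" using three_points_cocircular[of p q s] pqs by auto
  then show False using nc T(1) unfolding cocircular_def by blast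
qed

text \<open>
  If an affine dependence involves \<open>P i\<close>, then projecting from another point \<open>P j\<close> of the
  quadruplet turns it into a linear dependence of the three projected points.  All of them have inner
  product -1 with \<open>P j\<close>, so this dependence is again affine and the projection of \<open>P i\<close> lies on the
  line through the other two.  That line is the image of a circle through all four points.
\<close>

lemma not_cocircular_affinely_independent:
  fixes P :: "4 \<Rightarrow> real^4"
  assumes P: "\<And>i. P i \<in> S3" and nc: "\<not> cocircular (range P)"
  shows "affinely_independent P"
  unfolding affinely_independent_def
proof (intro allI impI, rule ccontr)
  fix \<mu> :: "4 \<Rightarrow> real" and i
  assume *: "(\<Sum>i\<in>UNIV. \<mu> i) = 0 \<and> (\<Sum>i\<in>UNIV. \<mu> i *\<^sub>R P i) = 0" and i: "\<mu> i \<noteq> 0"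
  obtain j k l where ijkl: "{i, j, k, l} = UNIV" using ex_four_indices .
  note d = four_indices[OF ijkl]
  have inj: "P x = P y \<longleftrightarrow> x = y" for x y using not_cocircular_inj[OF P nc] by (simp add: inj_eq)
  define p where "p = P j"
  define a where "a = (\<lambda>x. stereo p (P x))"
  define \<nu> where "\<nu> = (\<lambda>x. \<mu> x * ((norm (P x - p))\<^sup>2 / 2))"
  have \<mu>j: "\<mu> j = - \<mu> i - \<mu> k - \<mu> l" using * sum_four_indices[OF ijkl, of \<mu>] by simp
  have "\<mu> i *\<^sub>R (P i - p) + \<mu> k *\<^sub>R (P k - p) + \<mu> l *\<^sub>R (P l - p) = 0"
    using * unfolding sum_four_indices[OF ijkl] p_def by (simp add: \<mu>j algebra_simps)
  note z = this
  have s0: "\<nu> i *\<^sub>R a i + \<nu> k *\<^sub>R a k + \<nu> l *\<^sub>R a l = 0"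
  proof -
    have "\<mu> x *\<^sub>R (P x - p) = \<nu> x *\<^sub>R a x" if "x \<noteq> j" for x
      using that by (simp add: a_def \<nu>_def stereo_def p_def inj)
    then show ?thesis using z d by metis
  qed
  have ap: "a x \<bullet> p = - 1" if "x \<noteq> j" for x
    using stereo_inner[of p "P x"] P that by (simp add: a_def p_def inj)
  have "(\<nu> i *\<^sub>R a i + \<nu> k *\<^sub>R a k + \<nu> l *\<^sub>R a l) \<bullet> p = 0" unfolding s0 by simp
  then have \<nu>k: "\<nu> k = - \<nu> i - \<nu> l" using ap d by (simp add: inner_add)
  have \<nu>i: "\<nu> i \<noteq> 0" using i d by (simp add: \<nu>_def p_def inj)
  have "\<nu> i *\<^sub>R a i = \<nu> i *\<^sub>R a k + \<nu> l *\<^sub>R (a k - a l)" using s0 unfolding \<nu>k by (simp add: algebra_simps)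
  then have "(1 / \<nu> i) *\<^sub>R (\<nu> i *\<^sub>R a i) = (1 / \<nu> i) *\<^sub>R (\<nu> i *\<^sub>R a k + \<nu> l *\<^sub>R (a k - a l))" by simp
  then have "a i = a k + (\<nu> l / \<nu> i) *\<^sub>R (a k - a l)"
    using \<nu>i by (simp add: scaleR_add_right)
  then have ai: "a i = a k + (\<nu> l / \<nu> i * norm (a k - a l)) *\<^sub>R sgn (a k - a l)"
    by (simp only: norm_scaleR_sgn flip: scaleR_scaleR)
  define K where "K = circle3 p (P k) (P l)"
  have K: "K \<in> ocircles_S3" "(p, sgn (a k - a l)) \<in> K" "P k \<in> points K" "P l \<in> points K"
    using circle3_props[of p "P k" "P l"] P d by (auto simp: K_def p_def inj a_def)
  have "P i \<in> points K"
    using ocircle_points_iff[OF K(1-3), of "P i"] ai d by (auto simp: p_def inj a_def)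
  moreover have "p \<in> points K" using K(2) by (force simp: points_def)
  moreover have "range P = {P i, p, P k, P l}" unfolding p_def using ijkl by (metis image_empty image_insert)
  ultimately have "range P \<subseteq> points K" using K by simp
  then show False using nc K(1) unfolding cocircular_def by blast
qed

text \<open>
  Projecting from one point of an affinely independent family turns the other three into linearly
  independent vectors, in particular into a nondegenerate triangle.
\<close>

lemma stereo_affinely_independent:
  fixes P :: "4 \<Rightarrow> real^4"
  assumes ind: "affinely_independent P" and ijkl: "{i, j, k, l} = UNIV"
    and z: "\<alpha> *\<^sub>R stereo (P i) (P j) + \<beta> *\<^sub>R stereo (P i) (P k) + \<gamma> *\<^sub>R stereo (P i) (P l) = 0"
  shows "\<alpha> = 0" "\<beta> = 0" "\<gamma> = 0"
proof -
  note d = four_indices[OF ijkl]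
  have inj: "P x = P y \<longleftrightarrow> x = y" for x y using affinely_independent_inj[OF ind] by (simp add: inj_eq)
  define D where "D = (\<lambda>x. 2 / (norm (P x - P i))\<^sup>2)"
  define \<nu> where "\<nu> = (\<lambda>x. if x = j then \<alpha> * D j else if x = k then \<beta> * D k else if x = l then \<gamma> * D l else - \<alpha> * D j - \<beta> * D k - \<gamma> * D l)"
  have "(\<Sum>x\<in>UNIV. \<nu> x) = 0" using d unfolding sum_four_indices[OF ijkl] by (simp add: \<nu>_def)
  moreover have "(\<Sum>x\<in>UNIV. \<nu> x *\<^sub>R P x) = \<alpha> *\<^sub>R stereo (P i) (P j) + \<beta> *\<^sub>R stereo (P i) (P k) + \<gamma> *\<^sub>R stereo (P i) (P l)"
    using d unfolding sum_four_indices[OF ijkl] by (simp add: \<nu>_def stereo_def D_def algebra_simps)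
  ultimately have "\<forall>x. \<nu> x = 0" using ind z unfolding affinely_independent_def by simp
  then have "\<nu> j = 0" "\<nu> k = 0" "\<nu> l = 0" by auto
  then show "\<alpha> = 0" "\<beta> = 0" "\<gamma> = 0" using d by (auto simp: \<nu>_def D_def inj)
qed

section \<open>Dual points as incenters\<close>

text \<open>
  Clears the denominators in the direction of an angle bisector.
\<close>

lemma bisector_direction:
  fixes x y v w :: "'a::real_normed_vector"
  assumes "x \<noteq> y" "v \<noteq> w"
  shows "(norm (x - y) * norm (v - w)) *\<^sub>R (sgn (x - y) + sgn (v - w))
    = norm (v - w) *\<^sub>R (x - y) + norm (x - y) *\<^sub>R (v - w)"
proof -
  have "(p * q) *\<^sub>R (inverse p *\<^sub>R d + inverse q *\<^sub>R e) = q *\<^sub>R d + p *\<^sub>R e"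
    if "p \<noteq> 0" "q \<noteq> 0" for p q :: real and d e :: 'a
    using that by (simp add: scaleR_add_right mult.commute[of p] mult.assoc)
  then show ?thesis using assms by (simp add: sgn_div_norm)
qed

text \<open>
  The three interior angle bisectors of a triangle meet exactly in the point whose barycentric
  coordinates are the lengths of the opposite sides.  Two of the bisectors determine the point:
  comparing coefficients in the independent vectors \<open>a\<close>, \<open>b\<close>, \<open>c\<close> fixes the parameter \<open>\<tau>\<close>.
\<close>

lemma incenter_iff_bisectors:
  fixes a b c z :: "'a::real_normed_vector"
  assumes ind: "\<And>\<alpha> \<beta> \<gamma>. \<alpha> *\<^sub>R a + \<beta> *\<^sub>R b + \<gamma> *\<^sub>R c = 0 \<Longrightarrow> \<alpha> = 0 \<and> \<beta> = 0 \<and> \<gamma> = 0"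
  defines "A \<equiv> norm (b - c)" and "B \<equiv> norm (a - c)" and "C \<equiv> norm (a - b)"
  shows "(\<exists>\<tau>. z = a + \<tau> *\<^sub>R (sgn (a - b) + sgn (a - c))) \<and>
         (\<exists>\<tau>. z = b + \<tau> *\<^sub>R (sgn (b - a) + sgn (b - c))) \<and>
         (\<exists>\<tau>. z = c + \<tau> *\<^sub>R (sgn (c - a) + sgn (c - b))) \<longleftrightarrow>
         (A + B + C) *\<^sub>R z = A *\<^sub>R a + B *\<^sub>R b + C *\<^sub>R c" (is "?L \<longleftrightarrow> ?R")
proof -
  have ne: "a \<noteq> b" "a \<noteq> c" "b \<noteq> c" using ind[of 1 "-1" 0] ind[of 1 0 "-1"] ind[of 0 1 "-1"] by auto
  then have pos: "A > 0" "B > 0" "C > 0" by (auto simp: A_def B_def C_def)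
  have sym: "norm (b - a) = C" "norm (c - a) = B" "norm (c - b) = A" "norm (a - b) = C" "norm (a - c) = B" "norm (b - c) = A"
    by (simp_all add: A_def B_def C_def norm_minus_commute)
  define S where "S = A + B + C"
  have S: "S > 0" using pos by (simp add: S_def)
  show ?thesis
  proof
    assume ?L
    then obtain \<tau> \<sigma> where \<tau>: "z = a + \<tau> *\<^sub>R (sgn (a - b) + sgn (a - c))"
      and \<sigma>: "z = b + \<sigma> *\<^sub>R (sgn (b - a) + sgn (b - c))" by blast
    have "(1 + \<tau> / C + \<tau> / B + \<sigma> / C) *\<^sub>R a + (- \<tau> / C - 1 - \<sigma> / C - \<sigma> / A) *\<^sub>R b + (\<sigma> / A - \<tau> / B) *\<^sub>R c = 0"
      using \<tau> \<sigma> by (simp add: sgn_div_norm sym algebra_simps divide_inverse)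
    from ind[OF this] have e: "1 + \<tau> / C + \<tau> / B + \<sigma> / C = 0" "\<sigma> / A = \<tau> / B" by auto
    then have "\<sigma> = A * \<tau> / B" using pos by (simp add: field_simps)
    with e(1) have "\<tau> * S = - B * C" using pos by (simp add: S_def field_simps)
    then have t: "\<tau> = - B * C / S" using S by (simp add: field_simps)
    have "S *\<^sub>R z = S *\<^sub>R a - (B * C) *\<^sub>R (sgn (a - b) + sgn (a - c))"
      unfolding \<tau> t using S by (simp add: scaleR_add_right scaleR_diff_right)
    also have "\<dots> = S *\<^sub>R a - B *\<^sub>R (a - b) - C *\<^sub>R (a - c)"
      using bisector_direction[of a b a c] ne by (simp add: sym mult.commute[of B])
    finally show ?R by (simp add: S_def algebra_simps)
  next
    assume R: ?R
    have *: "\<exists>\<tau>. z = x + \<tau> *\<^sub>R (sgn (x - y) + sgn (x - w))"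
      if "S *\<^sub>R z = r *\<^sub>R x + q *\<^sub>R y + p *\<^sub>R w" "norm (x - y) = p" "norm (x - w) = q" "p > 0" "q > 0" "S = p + q + r"
      for x y w p q r
    proof -
      have "S *\<^sub>R (x + (- (p * q / S)) *\<^sub>R (sgn (x - y) + sgn (x - w)))
          = S *\<^sub>R x - (p * q) *\<^sub>R (sgn (x - y) + sgn (x - w))"
        using S by (simp add: scaleR_add_right scaleR_diff_right)
      also have "\<dots> = S *\<^sub>R x - q *\<^sub>R (x - y) - p *\<^sub>R (x - w)"
        using bisector_direction[of x y x w] that(2-5) by auto
      also have "\<dots> = S *\<^sub>R z" using that(1) by (simp add: that(6) algebra_simps)
      finally have "z = x + (- (p * q / S)) *\<^sub>R (sgn (x - y) + sgn (x - w))" using S by simp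
      then show ?thesis by blast
    qed
    show ?L
    proof (intro conjI)
      show "\<exists>\<tau>. z = a + \<tau> *\<^sub>R (sgn (a - b) + sgn (a - c))"
        by (rule *[of A _ B _ C]) (use R pos in \<open>simp_all add: sym S_def add_ac\<close>)
      show "\<exists>\<tau>. z = b + \<tau> *\<^sub>R (sgn (b - a) + sgn (b - c))"
        by (rule *[of B _ A _ C]) (use R pos in \<open>simp_all add: sym S_def add_ac\<close>)
      show "\<exists>\<tau>. z = c + \<tau> *\<^sub>R (sgn (c - a) + sgn (c - b))"
        by (rule *[of C _ A _ B]) (use R pos in \<open>simp_all add: sym S_def add_ac\<close>)
    qed
  qed
qed

text \<open>
  Seen from \<open>P i\<close>, the circles through \<open>P i\<close>, \<open>P j\<close> and a third point are side lines of the triangle with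
  vertices \<open>a\<close>, \<open>b\<close>, \<open>c\<close>.  Both tangents point towards \<open>a\<close>, so their sum is the direction of the
  interior angle bisector at \<open>a\<close>.
\<close>

lemma Gam_points_iff:
  assumes "P i \<in> S3" "P j \<in> S3" "P k \<in> S3" "P l \<in> S3"
    and "distinct [P i, P j, P k, P l]"
  defines "a \<equiv> stereo (P i) (P j)" and "b \<equiv> stereo (P i) (P k)" and "c \<equiv> stereo (P i) (P l)"
  assumes nz: "sgn (a - b) + sgn (a - c) \<noteq> 0"
  shows "x \<in> points (Gam P i j k l) \<longleftrightarrow> x = P i \<or>
     x \<noteq> P i \<and> (\<exists>\<tau>. stereo (P i) x = a + \<tau> *\<^sub>R (sgn (a - b) + sgn (a - c)))"
proof -
  define e where "e = sgn (a - b) + sgn (a - c)"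
  note K = circle3_props[of "P i" "P j" "P k", folded a_def b_def]
  note L = circle3_props[of "P i" "P j" "P l", folded a_def c_def]
  have ne: "P j \<noteq> P i" "P k \<noteq> P i" "P l \<noteq> P i" "P k \<noteq> P j" "P l \<noteq> P j" using assms(5) by auto
  note K = K[OF assms(1-3) ne(1,2,4)] and L = L[OF assms(1,2,4) ne(1,3,5)]
  note M = circular_bisector_props[OF K(1-3) L(1-3) ne(1) nz, folded Gam_def e_def]
  have "(\<exists>\<tau>. y = a + \<tau> *\<^sub>R sgn e) \<longleftrightarrow> (\<exists>\<tau>. y = a + \<tau> *\<^sub>R e)" for y
  proof safe
    fix \<tau> show "\<exists>\<sigma>. a + \<tau> *\<^sub>R sgn e = a + \<sigma> *\<^sub>R e"
      by (rule exI[of _ "\<tau> / norm e"]) (simp add: sgn_div_norm divide_inverse)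
  next
    fix \<tau> show "\<exists>\<sigma>. a + \<tau> *\<^sub>R e = a + \<sigma> *\<^sub>R sgn e"
      by (rule exI[of _ "\<tau> * norm e"]) (simp add: norm_scaleR_sgn flip: scaleR_scaleR)
  qed
  then show ?thesis
    using ocircle_points_iff[OF M, of x] assms(5) unfolding e_def a_def by auto
qed

text \<open>
  The points common to the three bisecting circles, apart from \<open>P i\<close>, are those that project to the
  incenter.  Hence any point with this projection is the dual point.
\<close>

lemma dual_eqI:
  fixes P :: "4 \<Rightarrow> real^4"
  assumes P: "\<And>i. P i \<in> S3" and ind: "affinely_independent P" and X: "X \<noteq> P i"
    and inc: "\<And>j k l. {i, j, k, l} = UNIV \<Longrightarrow>
      (let a = stereo (P i) (P j); b = stereo (P i) (P k); c = stereo (P i) (P l) in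
       (norm (b - c) + norm (a - c) + norm (a - b)) *\<^sub>R stereo (P i) X =
        norm (b - c) *\<^sub>R a + norm (a - c) *\<^sub>R b + norm (a - b) *\<^sub>R c)"
  shows "dual P i = X"
proof -
  have inj: "P x = P y \<longleftrightarrow> x = y" for x y using affinely_independent_inj[OF ind] by (simp add: inj_eq)
  have main: "points (Gam P i j k l) \<inter> points (Gam P i k j l) \<inter> points (Gam P i l j k) = {P i, X}"
    if ijkl: "{i, j, k, l} = UNIV" for j k l
  proof -
    define a b c where "a = stereo (P i) (P j)" and "b = stereo (P i) (P k)" and "c = stereo (P i) (P l)"
    note abc = a_def b_def c_def
    note d = four_indices[OF ijkl]
    have ind': "\<alpha> = 0 \<and> \<beta> = 0 \<and> \<gamma> = 0" if "\<alpha> *\<^sub>R a + \<beta> *\<^sub>R b + \<gamma> *\<^sub>R c = 0" for \<alpha> \<beta> \<gamma>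
      using stereo_affinely_independent[OF ind ijkl] that unfolding abc by blast
    have ne: "a \<noteq> b" "a \<noteq> c" "b \<noteq> c" using ind'[of 1 "-1" 0] ind'[of 1 0 "-1"] ind'[of 0 1 "-1"] by auto
    have nz: "sgn (a - b) + sgn (a - c) \<noteq> 0" "sgn (b - a) + sgn (b - c) \<noteq> 0" "sgn (c - a) + sgn (c - b) \<noteq> 0"
    proof -
      let ?n = "\<lambda>x. inverse (norm x)"
      show "sgn (a - b) + sgn (a - c) \<noteq> 0"
        using ind'[of "?n (a - b) + ?n (a - c)" "- ?n (a - b)" "- ?n (a - c)"] ne
        by (auto simp: sgn_div_norm algebra_simps)
      show "sgn (b - a) + sgn (b - c) \<noteq> 0"
        using ind'[of "- ?n (b - a)" "?n (b - a) + ?n (b - c)" "- ?n (b - c)"] ne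
        by (auto simp: sgn_div_norm algebra_simps)
      show "sgn (c - a) + sgn (c - b) \<noteq> 0"
        using ind'[of "- ?n (c - a)" "- ?n (c - b)" "?n (c - a) + ?n (c - b)"] ne
        by (auto simp: sgn_div_norm algebra_simps)
    qed
    let ?S = "norm (b - c) + norm (a - c) + norm (a - b)"
    let ?I = "norm (b - c) *\<^sub>R a + norm (a - c) *\<^sub>R b + norm (a - b) *\<^sub>R c"
    have S: "?S \<noteq> 0" using ne by (smt (verit) norm_ge_zero right_minus_eq norm_eq_zero)
    have IX: "?S *\<^sub>R stereo (P i) X = ?I" using inc[OF ijkl] by (simp add: Let_def abc)
    have G: "x \<in> points (Gam P i j k l) \<longleftrightarrow> x = P i \<or> x \<noteq> P i \<and> (\<exists>\<tau>. stereo (P i) x = a + \<tau> *\<^sub>R (sgn (a - b) + sgn (a - c)))"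
      "x \<in> points (Gam P i k j l) \<longleftrightarrow> x = P i \<or> x \<noteq> P i \<and> (\<exists>\<tau>. stereo (P i) x = b + \<tau> *\<^sub>R (sgn (b - a) + sgn (b - c)))"
      "x \<in> points (Gam P i l j k) \<longleftrightarrow> x = P i \<or> x \<noteq> P i \<and> (\<exists>\<tau>. stereo (P i) x = c + \<tau> *\<^sub>R (sgn (c - a) + sgn (c - b)))" for x
      using Gam_points_iff[of P i j k l x] Gam_points_iff[of P i k j l x] Gam_points_iff[of P i l j k x] P nz d d[symmetric]
      by (simp_all add: inj abc)
    have "x \<in> points (Gam P i j k l) \<inter> points (Gam P i k j l) \<inter> points (Gam P i l j k) \<longleftrightarrow>
      x = P i \<or> x \<noteq> P i \<and> ?S *\<^sub>R stereo (P i) x = ?I" for x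
      using incenter_iff_bisectors[where z = "stereo (P i) x", OF ind'] unfolding Int_iff G by blast
    moreover have "x \<noteq> P i \<and> ?S *\<^sub>R stereo (P i) x = ?I \<longleftrightarrow> x = X" for x
      using S X stereo_inject[of x "P i" X] unfolding IX[symmetric] by auto
    ultimately show ?thesis by blast
  qed
  obtain j k l where ijkl: "{i, j, k, l} = UNIV" using ex_four_indices .
  show ?thesis unfolding dual_def
  proof (rule the_equality)
    show "\<forall>j k l. {i, j, k, l} = UNIV \<longrightarrow> points (Gam P i j k l) \<inter> points (Gam P i k j l) \<inter> points (Gam P i l j k) = {P i, X}"
      using main by blast
    fix Y assume "\<forall>j k l. {i, j, k, l} = UNIV \<longrightarrow> points (Gam P i j k l) \<inter> points (Gam P i k j l) \<inter> points (Gam P i l j k) = {P i, Y}"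
    then have "{P i, Y} = {P i, X}" using main[OF ijkl] ijkl by blast
    then show "Y = X" using X by (auto simp: doubleton_eq_iff)
  qed
qed

section \<open>Balanced weights and the formula for the dual\<close>

text \<open>
  Geometrically, \<open>(m i *\<^sub>R P i, m i)\<close> are light-like vectors of Minkowski space, with negated Lorentz
  products \<open>m i * m j * (1 - P i \<bullet> P j)\<close>, half the squared distances of \<open>P i\<close> and \<open>P j\<close> with conformal factors.
  The condition says that opposite edges of the rescaled tetrahedron have equal length.
\<close>

definition balanced :: "(4 \<Rightarrow> real) \<Rightarrow> (4 \<Rightarrow> real^4) \<Rightarrow> bool" where
  "balanced m P \<longleftrightarrow> (\<forall>i. m i > 0) \<and> (\<forall>i j k l. {i, j, k, l} = UNIV \<longrightarrow>
     m i * m j * (1 - P i \<bullet> P j) = m k * m l * (1 - P k \<bullet> P l))"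

text \<open>
  \<open>(dual_vector m P i, dual_weight m i)\<close> is the light-like vector \<open>s - 2 x\<close>, where \<open>x\<close> is the vector
  of \<open>P i\<close> and \<open>s\<close> is the sum of all four.
\<close>

definition dual_weight :: "(4 \<Rightarrow> real) \<Rightarrow> 4 \<Rightarrow> real" where
  "dual_weight m i = (\<Sum>j\<in>UNIV. m j) - 2 * m i"

definition dual_vector :: "(4 \<Rightarrow> real) \<Rightarrow> (4 \<Rightarrow> real^4) \<Rightarrow> 4 \<Rightarrow> real^4" where
  "dual_vector m P i = (\<Sum>j\<in>UNIV. m j *\<^sub>R P j) - (2 * m i) *\<^sub>R P i"

definition dual_point :: "(4 \<Rightarrow> real) \<Rightarrow> (4 \<Rightarrow> real^4) \<Rightarrow> 4 \<Rightarrow> real^4" where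
  "dual_point m P i = (1 / dual_weight m i) *\<^sub>R dual_vector m P i"

lemma one_minus_inner_pos:
  fixes x p :: "real^4"
  assumes "p \<in> S3" "x \<in> S3" "x \<noteq> p" shows "1 - x \<bullet> p > 0"
  unfolding one_minus_inner[OF assms(1,2)] using assms(3) by simp

lemma dual_weight_four:
  assumes "{i, j, k, l} = UNIV" shows "dual_weight m i = m j + m k + m l - m i"
  by (simp add: dual_weight_def sum_four_indices[OF assms])

lemma dual_vector_four:
  assumes "{i, j, k, l} = UNIV"
  shows "dual_vector m P i = m j *\<^sub>R P j + m k *\<^sub>R P k + m l *\<^sub>R P l - m i *\<^sub>R P i"
proof -
  have "(2 * m i) *\<^sub>R P i = m i *\<^sub>R P i + m i *\<^sub>R P i"
    by (simp flip: scaleR_add_left)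
  then show ?thesis unfolding dual_vector_def sum_four_indices[OF assms] by simp
qed

lemma perm_four:
  fixes i j k l :: 4
  assumes "{i, j, k, l} = UNIV"
  shows "{i, k, j, l} = UNIV" "{i, l, j, k} = UNIV" "{j, i, k, l} = UNIV"
  unfolding assms[symmetric] by blast+

context
  fixes m :: "4 \<Rightarrow> real" and P :: "4 \<Rightarrow> real^4"
  assumes P: "\<And>i. P i \<in> S3" and inj: "inj P" and bal: "balanced m P"
begin

lemma weight_pos: "m i > 0"
  using bal by (simp add: balanced_def)

lemma P_unit: "P i \<bullet> P i = 1"
  using P[of i] by (simp add: norm_eq_1)

lemma balanced_eqs:
  assumes "{i, j, k, l} = UNIV"
  shows "m i * m j * (1 - P i \<bullet> P j) = m k * m l * (1 - P k \<bullet> P l)"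
    "m i * m k * (1 - P i \<bullet> P k) = m j * m l * (1 - P j \<bullet> P l)"
    "m i * m l * (1 - P i \<bullet> P l) = m j * m k * (1 - P j \<bullet> P k)"
proof -
  have "m i * m j * (1 - P i \<bullet> P j) = m k * m l * (1 - P k \<bullet> P l)"
    if "{i, j, k, l} = UNIV" for i j k l
    using bal that by (simp add: balanced_def)
  from this[OF assms] this[OF perm_four(1)[OF assms]] this[OF perm_four(2)[OF assms]]
  show "m i * m j * (1 - P i \<bullet> P j) = m k * m l * (1 - P k \<bullet> P l)"
    "m i * m k * (1 - P i \<bullet> P k) = m j * m l * (1 - P j \<bullet> P l)"
    "m i * m l * (1 - P i \<bullet> P l) = m j * m k * (1 - P j \<bullet> P k)" .
qed

text \<open>
  Expanding the Lorentz square of \<open>s - 2 x\<close>, the three edges at \<open>P i\<close> occur with the opposite sign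
  of the three edges of the opposite face, and balance makes them cancel.
\<close>

lemma dual_vector_null: "dual_vector m P i \<bullet> dual_vector m P i = (dual_weight m i)\<^sup>2"
proof -
  obtain j k l where ijkl: "{i, j, k, l} = UNIV" using ex_four_indices .
  note sym = inner_commute[of "P j" "P i"] inner_commute[of "P k" "P i"] inner_commute[of "P l" "P i"]
    inner_commute[of "P k" "P j"] inner_commute[of "P l" "P j"] inner_commute[of "P l" "P k"]
  have "dual_vector m P i \<bullet> dual_vector m P i - (dual_weight m i)\<^sup>2 =
      2 * (m i * m j * (1 - P i \<bullet> P j) - m k * m l * (1 - P k \<bullet> P l)) +
      2 * (m i * m k * (1 - P i \<bullet> P k) - m j * m l * (1 - P j \<bullet> P l)) +
      2 * (m i * m l * (1 - P i \<bullet> P l) - m j * m k * (1 - P j \<bullet> P k))"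
    unfolding dual_vector_four[OF ijkl] dual_weight_four[OF ijkl]
    by (simp only: inner_add inner_diff inner_scaleR_left inner_scaleR_right P_unit sym) algebra
  also have "\<dots> = 0" unfolding balanced_eqs[OF ijkl] by simp
  finally show ?thesis by (rule eq_iff_diff_eq_0[THEN iffD2])
qed

text \<open>
  In the Lorentz product of \<open>s - 2 x\<close> and \<open>s - 2 y\<close> only the edge of \<open>P i\<close> and \<open>P j\<close> and its opposite
  edge survive, each with the factor 2.
\<close>

lemma dual_vector_inner:
  assumes "i \<noteq> j"
  shows "dual_weight m i * dual_weight m j - dual_vector m P i \<bullet> dual_vector m P j
    = 4 * (m i * m j * (1 - P i \<bullet> P j))"
proof -
  have "card (UNIV - {i} - {j} :: 4 set) = 2" using assms by (simp add: card_Diff_singleton)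
  then obtain k l where "UNIV - {i} - {j} = {k, l}" unfolding card_2_iff by blast
  then have ijkl: "{i, j, k, l} = UNIV" by auto
  note sym = inner_commute[of "P j" "P i"] inner_commute[of "P k" "P i"] inner_commute[of "P l" "P i"]
    inner_commute[of "P k" "P j"] inner_commute[of "P l" "P j"] inner_commute[of "P l" "P k"]
  note four = dual_vector_four[OF ijkl] dual_weight_four[OF ijkl]
    dual_vector_four[OF perm_four(3)[OF ijkl]] dual_weight_four[OF perm_four(3)[OF ijkl]]
  have "dual_weight m i * dual_weight m j - dual_vector m P i \<bullet> dual_vector m P j =
      2 * (m i * m j * (1 - P i \<bullet> P j)) + 2 * (m k * m l * (1 - P k \<bullet> P l))"
    unfolding four
    by (simp only: inner_add inner_diff inner_scaleR_left inner_scaleR_right P_unit sym) algebra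
  then show ?thesis unfolding balanced_eqs(1)[OF ijkl] by simp
qed

lemma dual_vector_inner_base:
  assumes ijkl: "{i, j, k, l} = UNIV"
  shows "dual_weight m i - dual_vector m P i \<bullet> P i =
    m j * (1 - P j \<bullet> P i) + m k * (1 - P k \<bullet> P i) + m l * (1 - P l \<bullet> P i)"
  by (simp add: dual_vector_four[OF ijkl] dual_weight_four[OF ijkl] inner_add inner_diff P_unit algebra_simps)

text \<open>
  By \<open>dual_vector_inner_base\<close> the dual light-like vector has negative Lorentz product with the vector
  of \<open>P i\<close>, which points to the future.  So it points to the future as well; otherwise the
  Cauchy-Schwarz inequality would be violated.
\<close>

lemma dual_weight_pos: "dual_weight m i > 0"
proof (rule ccontr)
  assume neg: "\<not> dual_weight m i > 0"
  obtain j k l where ijkl: "{i, j, k, l} = UNIV" using ex_four_indices .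
  note d = four_indices[OF ijkl]
  have pos: "1 - P x \<bullet> P i > 0" if "x \<noteq> i" for x
    using one_minus_inner_pos[OF P P] that inj by (simp add: inj_eq)
  have "dual_weight m i - dual_vector m P i \<bullet> P i > 0"
    unfolding dual_vector_inner_base[OF ijkl] using d
    by (intro add_pos_pos mult_pos_pos weight_pos pos) auto
  moreover have "norm (dual_vector m P i) = \<bar>dual_weight m i\<bar>"
    using dual_vector_null[of i] by (simp add: norm_eq_sqrt_inner)
  moreover have "\<bar>dual_vector m P i \<bullet> P i\<bar> \<le> norm (dual_vector m P i)"
    using Cauchy_Schwarz_ineq2[of "dual_vector m P i" "P i"] P[of i] by simp
  ultimately show False using neg by linarith
qed

lemma dual_point_S3: "dual_point m P i \<in> S3"
proof -
  have "norm (dual_vector m P i) = dual_weight m i"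
    using dual_weight_pos[of i] by (simp add: norm_eq_sqrt_inner dual_vector_null)
  then show ?thesis using dual_weight_pos[of i] by (simp add: dual_point_def)
qed

lemma dual_vector_eq: "dual_vector m P i = dual_weight m i *\<^sub>R dual_point m P i"
  using dual_weight_pos[of i] by (simp add: dual_point_def)

lemma dual_point_inner:
  assumes "i \<noteq> j"
  shows "dual_weight m i * dual_weight m j * (1 - dual_point m P i \<bullet> dual_point m P j)
    = 4 * (m i * m j * (1 - P i \<bullet> P j))"
  using dual_vector_inner[OF assms] by (simp add: dual_vector_eq algebra_simps)

lemma dual_balanced: "balanced (dual_weight m) (dual_point m P)"
  unfolding balanced_def
proof (intro conjI allI impI)
  fix i j k l :: 4 assume ijkl: "{i, j, k, l} = UNIV"
  show "dual_weight m i * dual_weight m j * (1 - dual_point m P i \<bullet> dual_point m P j) =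
    dual_weight m k * dual_weight m l * (1 - dual_point m P k \<bullet> dual_point m P l)"
    unfolding dual_point_inner[OF four_indices(1)[OF ijkl]] dual_point_inner[OF four_indices(6)[OF ijkl]]
      balanced_eqs(1)[OF ijkl] ..
qed (rule dual_weight_pos)

lemma sum_dual_weight: "(\<Sum>j\<in>UNIV. dual_weight m j) = 2 * (\<Sum>j\<in>UNIV. m j)"
  by (simp add: dual_weight_def sum_subtractf flip: sum_distrib_left)

lemma dual_dual_weight: "dual_weight (dual_weight m) i = 4 * m i"
  unfolding dual_weight_def[of "dual_weight m"] sum_dual_weight by (simp add: dual_weight_def)

lemma sum_dual_vector: "(\<Sum>j\<in>UNIV. dual_vector m P j) = 2 *\<^sub>R (\<Sum>j\<in>UNIV. m j *\<^sub>R P j)"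
proof -
  let ?s = "\<Sum>j\<in>UNIV. m j *\<^sub>R P j"
  have "(\<Sum>j\<in>UNIV. dual_vector m P j) = (\<Sum>j\<in>(UNIV :: 4 set). ?s) - 2 *\<^sub>R ?s"
    by (simp add: dual_vector_def sum_subtractf scaleR_sum_right)
  also have "(\<Sum>j\<in>(UNIV :: 4 set). ?s) = 4 *\<^sub>R ?s" by (simp only: sum_constant_scaleR) simp
  finally show ?thesis by (simp flip: scaleR_diff_left)
qed

text \<open>
  The sum of the four vectors \<open>s - 2 x\<close> is \<open>4 s - 2 s = 2 s\<close>, so the second dual of \<open>x\<close> is
  \<open>2 s - 2 (s - 2 x) = 4 x\<close>, a positive multiple of \<open>x\<close>.
\<close>

lemma dual_dual_point: "dual_point (dual_weight m) (dual_point m P) i = P i"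
proof -
  have "dual_vector (dual_weight m) (dual_point m P) i
      = (\<Sum>j\<in>UNIV. dual_vector m P j) - 2 *\<^sub>R dual_vector m P i"
    by (simp add: dual_vector_def[of "dual_weight m"] dual_vector_eq)
  also have "\<dots> = (4 * m i) *\<^sub>R P i"
    unfolding sum_dual_vector by (simp add: dual_vector_def scaleR_diff_right)
  finally show ?thesis using weight_pos[of i] by (simp add: dual_point_def[of "dual_weight m"] dual_dual_weight)
qed

text \<open>
  An affine dependence of the dual points is a linear dependence of the vectors \<open>s - 2 x\<close>.
  Sorting by the independent vectors \<open>x\<close>, the coefficients are \<open>T - 2 \<nu> i\<close>, where \<open>T\<close> is the
  sum of all \<open>\<nu> i\<close>.  If they vanish, summing gives \<open>4 T = 2 T\<close>, so all \<open>\<nu> i\<close> vanish.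
\<close>

lemma dual_affinely_independent:
  assumes ind: "affinely_independent P"
  shows "affinely_independent (dual_point m P)"
  unfolding affinely_independent_def
proof (intro allI impI)
  fix \<mu> :: "4 \<Rightarrow> real" and i
  assume *: "(\<Sum>i\<in>UNIV. \<mu> i) = 0 \<and> (\<Sum>i\<in>UNIV. \<mu> i *\<^sub>R dual_point m P i) = 0"
  define \<nu> where "\<nu> = (\<lambda>i. \<mu> i / dual_weight m i)"
  define T where "T = (\<Sum>i\<in>UNIV. \<nu> i)"
  have W: "dual_weight m i \<noteq> 0" for i using dual_weight_pos[of i] by simp
  have "(\<Sum>i\<in>UNIV. \<nu> i * dual_weight m i) = 0" using * W by (simp add: \<nu>_def)
  then have 1: "(\<Sum>i\<in>UNIV. (T - 2 * \<nu> i) * m i) = 0"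
    by (simp add: dual_weight_def algebra_simps sum_subtractf T_def flip: sum_distrib_left sum_distrib_right)
  have "(\<Sum>i\<in>UNIV. ((T - 2 * \<nu> i) * m i) *\<^sub>R P i)
      = T *\<^sub>R (\<Sum>i\<in>UNIV. m i *\<^sub>R P i) - (\<Sum>i\<in>UNIV. \<nu> i *\<^sub>R (2 * m i) *\<^sub>R P i)"
  proof -
    have "((T - 2 * \<nu> i) * m i) *\<^sub>R P i = T *\<^sub>R m i *\<^sub>R P i - \<nu> i *\<^sub>R (2 * m i) *\<^sub>R P i" for i
      unfolding scaleR_scaleR scaleR_diff_left[symmetric] by (simp add: left_diff_distrib)
    then show ?thesis by (simp add: sum_subtractf scaleR_sum_right)
  qed
  also have "\<dots> = (\<Sum>i\<in>UNIV. \<nu> i *\<^sub>R dual_vector m P i)"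
    by (simp only: T_def dual_vector_def scaleR_diff_right sum_subtractf scaleR_sum_left)
  also have "\<dots> = 0" using * by (simp add: \<nu>_def dual_point_def)
  finally have 2: "(\<Sum>i\<in>UNIV. ((T - 2 * \<nu> i) * m i) *\<^sub>R P i) = 0" .
  have "\<forall>i. (T - 2 * \<nu> i) * m i = 0" using ind 1 2 unfolding affinely_independent_def by blast
  then have \<nu>: "2 * \<nu> i = T" for i using weight_pos[of i] by (metis eq_iff_diff_eq_0 less_irrefl mult_eq_0_iff)
  have "2 * T = (\<Sum>i\<in>UNIV. 2 * \<nu> i)" unfolding T_def by (simp add: sum_distrib_left)
  also have "\<dots> = 4 * T" unfolding \<nu> by simp
  finally have "\<nu> i = 0" using \<nu>[of i] by simp
  then show "\<mu> i = 0" using W by (simp add: \<nu>_def)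
qed

text \<open>
  The factor is the same for all three edges at \<open>P i\<close>.  This is how balanced weights encode the side
  lengths of the triangle seen from \<open>P i\<close>.
\<close>

lemma opposite_edges:
  assumes ijkl: "{i, j, k, l} = UNIV"
  shows "m j * norm (P j - P i) = sqrt (m j * m k * m l / m i) * norm (P k - P l)"
proof -
  have "m i * m j * (norm (P j - P i))\<^sup>2 = m k * m l * (norm (P k - P l))\<^sup>2"
    using balanced_eqs(1)[OF ijkl] one_minus_inner[OF P[of j] P[of i]] one_minus_inner[OF P[of l] P[of k]]
    by (simp add: norm_minus_commute)
  then have "(m j * norm (P j - P i))\<^sup>2 = m j * m k * m l / m i * (norm (P k - P l))\<^sup>2"
    using weight_pos[of i] by (simp add: field_simps power2_eq_square)
  also have "\<dots> = (sqrt (m j * m k * m l / m i) * norm (P k - P l))\<^sup>2"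
    using weight_pos[of i] weight_pos[of j] weight_pos[of k] weight_pos[of l] by (simp add: power_mult_distrib)
  finally show ?thesis using weight_pos[of i] weight_pos[of j] weight_pos[of k] weight_pos[of l]
    by (simp add: power2_eq_iff_nonneg)
qed

text \<open>
  The vector \<open>dual_point m P i - P i\<close> is a positive multiple of the sum of all
  \<open>m x *\<^sub>R (P x - P i)\<close>.  In terms of the projections, \<open>P x\<close> gets the coefficient
  \<open>m x * (norm (P x - P i))\<^sup>2\<close>, which by \<open>opposite_edges\<close> is proportional to the side of the
  projected triangle opposite to its vertex \<open>stereo (P i) (P x)\<close>.  These are the barycentric coordinates
  of the incenter.
\<close>

lemma dual_eq_dual_point:
  assumes ind: "affinely_independent P"
  shows "dual P i = dual_point m P i"
proof (rule dual_eqI[OF P ind])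
  have pos: "1 - P x \<bullet> P i > 0" "norm (P x - P i) > 0" if "x \<noteq> i" for x
    using one_minus_inner_pos[OF P P] that inj by (simp_all add: inj_eq)
  let ?X = "dual_point m P i" and ?W = "dual_weight m i"
  have W: "?W > 0" by (rule dual_weight_pos)
  have Xi: "?W * (1 - ?X \<bullet> P i) = m j * (1 - P j \<bullet> P i) + m k * (1 - P k \<bullet> P i) + m l * (1 - P l \<bullet> P i)"
    if "{i, j, k, l} = UNIV" for j k l
    using dual_vector_inner_base[OF that] by (simp add: dual_vector_eq algebra_simps)
  show ne: "?X \<noteq> P i"
  proof
    assume "?X = P i"
    obtain j k l where ijkl: "{i, j, k, l} = UNIV" using ex_four_indices .
    note d = four_indices[OF ijkl]
    have "m j * (1 - P j \<bullet> P i) + m k * (1 - P k \<bullet> P i) + m l * (1 - P l \<bullet> P i) > 0"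
      using d by (intro add_pos_pos mult_pos_pos weight_pos pos) auto
    then show False using Xi[OF ijkl] \<open>?X = P i\<close> by (simp add: P_unit)
  qed
  fix j k l assume ijkl: "{i, j, k, l} = UNIV"
  note d = four_indices[OF ijkl]
  define D where "D = (\<lambda>x. norm (P x - P i))"
  have D: "D j > 0" "D k > 0" "D l > 0" using d pos by (auto simp: D_def)
  define \<rho> where "\<rho> = sqrt (m j * m k * m l / m i)"
  have \<rho>: "\<rho> > 0" using weight_pos by (simp add: \<rho>_def)
  define a where "a = (\<lambda>x. stereo (P i) (P x))"
  define c where "c = \<rho> * D j * D k * D l / 2"
  have c: "c > 0" using \<rho> D by (simp add: c_def)
  have e: "m j * D j = \<rho> * norm (P k - P l)" "m k * D k = \<rho> * norm (P j - P l)" "m l * D l = \<rho> * norm (P j - P k)"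
    using opposite_edges[OF ijkl] opposite_edges[OF perm_four(1)[OF ijkl]] opposite_edges[OF perm_four(2)[OF ijkl]]
    by (simp_all add: \<rho>_def D_def mult_ac)
  have n: "norm (a x - a y) = 2 * norm (P x - P y) / (D x * D y)" if "x \<noteq> i" "y \<noteq> i" for x y
    unfolding a_def D_def using that inj by (intro norm_stereo_diff) (auto simp: inj_eq)
  \<comment> \<open>The common factor \<open>c\<close> comes from clearing the denominators in the distances of the projections.\<close>
  have w: "m j * (D j)\<^sup>2 = c * norm (a k - a l)" "m k * (D k)\<^sup>2 = c * norm (a j - a l)" "m l * (D l)\<^sup>2 = c * norm (a j - a k)"
    using d D e by (simp_all add: n c_def power2_eq_square field_simps)
  define S where "S = norm (a k - a l) + norm (a j - a l) + norm (a j - a k)"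
  have N: "(norm (?X - P i))\<^sup>2 = c * S / ?W"
  proof -
    have "?W * (norm (?X - P i))\<^sup>2 = m j * (D j)\<^sup>2 + m k * (D k)\<^sup>2 + m l * (D l)\<^sup>2"
      using Xi[OF ijkl] unfolding one_minus_inner[OF P P] one_minus_inner[OF P dual_point_S3]
      by (simp add: D_def flip: add_divide_distrib)
    then show ?thesis unfolding w using W by (simp add: S_def field_simps)
  qed
  have sd: "m x *\<^sub>R (P x - P i) = (m x * (D x)\<^sup>2 / 2) *\<^sub>R a x" if "x \<noteq> i" for x
    using pos(2)[OF that] by (simp add: a_def D_def stereo_def)
  have "?W *\<^sub>R (?X - P i) = m j *\<^sub>R (P j - P i) + m k *\<^sub>R (P k - P i) + m l *\<^sub>R (P l - P i)"
    unfolding scaleR_diff_right[of ?W] dual_vector_eq[symmetric]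
    unfolding dual_vector_four[OF ijkl] dual_weight_four[OF ijkl] by (simp add: algebra_simps)
  also have "\<dots> = (c / 2) *\<^sub>R (norm (a k - a l) *\<^sub>R a j + norm (a j - a l) *\<^sub>R a k + norm (a j - a k) *\<^sub>R a l)"
    using d by (simp add: sd w scaleR_add_right)
  finally have V: "?W *\<^sub>R (?X - P i) = (c / 2) *\<^sub>R (norm (a k - a l) *\<^sub>R a j + norm (a j - a l) *\<^sub>R a k + norm (a j - a k) *\<^sub>R a l)" (is "_ = _ *\<^sub>R ?I") .
  have S: "S \<noteq> 0" using N ne by auto
  have "S *\<^sub>R stereo (P i) ?X = (2 / c) *\<^sub>R (?W *\<^sub>R (?X - P i))"
    unfolding stereo_def N using S c W by simp
  also have "\<dots> = ?I" unfolding V using c by simp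
  finally show "let a = stereo (P i) (P j); b = stereo (P i) (P k); c = stereo (P i) (P l) in
       (norm (b - c) + norm (a - c) + norm (a - b)) *\<^sub>R stereo (P i) ?X =
        norm (b - c) *\<^sub>R a + norm (a - c) *\<^sub>R b + norm (a - b) *\<^sub>R c"
    by (simp add: Let_def S_def a_def)
qed

end

text \<open>
  The reciprocal product of the three edges at each point works: in the product for a pair of points,
  the edge between them occurs squared and cancels, leaving the four edges that join it to the
  opposite pair.
\<close>

lemma ex_balanced:
  fixes P :: "4 \<Rightarrow> real^4"
  assumes P: "\<And>i. P i \<in> S3" and inj: "inj P"
  shows "\<exists>m. balanced m P"
proof -
  define m where "m = (\<lambda>i. inverse (\<Prod>x\<in>UNIV - {i}. norm (P i - P x)))"
  have pos: "norm (P x - P y) > 0" if "x \<noteq> y" for x y using inj that by (simp add: inj_eq)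
  have "m i > 0" for i unfolding m_def using inj by (auto intro!: prod_pos simp: inj_eq)
  moreover have "m i * m j * (1 - P i \<bullet> P j) = m k * m l * (1 - P k \<bullet> P l)" if ijkl: "{i, j, k, l} = UNIV" for i j k l
  proof -
    note d = four_indices[OF ijkl]
    have "UNIV - {i} = {j, k, l}" "UNIV - {j} = {i, k, l}" "UNIV - {k} = {i, j, l}" "UNIV - {l} = {i, j, k}"
      using d ijkl by auto
    then have m: "m i = inverse (norm (P i - P j) * norm (P i - P k) * norm (P i - P l))"
      "m j = inverse (norm (P i - P j) * norm (P j - P k) * norm (P j - P l))"
      "m k = inverse (norm (P i - P k) * norm (P j - P k) * norm (P k - P l))"
      "m l = inverse (norm (P i - P l) * norm (P j - P l) * norm (P k - P l))"
      using d unfolding m_def by (simp_all add: norm_minus_commute mult.assoc)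
    have D: "1 - P i \<bullet> P j = (norm (P i - P j))\<^sup>2 / 2" "1 - P k \<bullet> P l = (norm (P k - P l))\<^sup>2 / 2"
      using one_minus_inner P by blast+
    have edges: "inverse (a * b * c) * inverse (a * d * e) * (a\<^sup>2 / 2)
        = inverse (b * d * f) * inverse (c * e * f) * (f\<^sup>2 / 2)"
      if "a > 0" "b > 0" "c > 0" "d > 0" "e > 0" "f > 0" for a b c d e f :: real
      using that by (simp add: field_simps power2_eq_square)
    show ?thesis unfolding m D using d by (intro edges pos)
  qed
  ultimately show ?thesis unfolding balanced_def by blast
qed

section \<open>Duality is an involution\<close>

theorem theorem1p4:
  fixes P :: "4 \<Rightarrow> real^4"
  assumes "\<And>i. P i \<in> S3"
    and "\<not> cocircular (range P)"
  shows "dual (dual P) = P"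
proof -
  have ind: "affinely_independent P" by (rule not_cocircular_affinely_independent[OF assms])
  note inj = affinely_independent_inj[OF ind]
  obtain m where bal: "balanced m P" using ex_balanced[OF assms(1) inj] by blast
  note H = assms(1) inj bal
  let ?Q = "dual_point m P"
  have Q: "dual P = ?Q" using dual_eq_dual_point[OF H ind] by blast
  have indQ: "affinely_independent ?Q" by (rule dual_affinely_independent[OF H ind])
  have "dual ?Q = dual_point (dual_weight m) ?Q"
    using dual_eq_dual_point[OF dual_point_S3[OF H] affinely_independent_inj[OF indQ] dual_balanced[OF H] indQ] by blast
  also have "\<dots> = P" using dual_dual_point[OF H] by blast
  finally show ?thesis by (simp add: Q)
qed

end
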